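(* Assume that the step sizes satisfy $|\Psi^{-1}|<1/L_{\mathcal D}$ (with $\Psi$, $L_{\mathcal D}$ as defined in the context). Let $v^k=\mathrm{col}(\boldsymbol x^k,\boldsymbol z^k,\boldsymbol\lambda^k)$, $k\ge 0$, be generated from any $x_i^0\in\Omega_i$, $z_i^0\in\mathbb R^m$, $\lambda_i^0\in\mathbb R^m_{\ge 0}$ ($i=1,\dots,N$) by the distributed forward-backward-forward algorithm $$u^{k}=J_{\Psi^{-1}\mathcal C}\big(v^k-\Psi^{-1}\mathcal D v^k\big),\qquad v^{k+1}=u^k+\Psi^{-1}\big(\mathcal D v^k-\mathcal D u^k\big).$$ Then $v^k=\mathrm{col}(\boldsymbol x^k,\boldsymbol z^k,\boldsymbol\lambda^k)$ converges to a point of $\mathrm{zer}(\mathcal A+\mathcal B+\mathcal C)$, and thus the primal variable $\boldsymbol x^k$ converges to a variational generalized Nash equilibrium (v-GNE) of the game.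
   Context: Game. There are $N$ agents, $i\in\mathcal I=\{1,\dots,N\}$; agent $i$ chooses $x_i\in\mathbb R^{n_i}$; $n=\sum_i n_i$, $\boldsymbol x=\mathrm{col}(x_1,\dots,x_N)\in\mathbb R^n$, and $\boldsymbol x_{-i}$ collects all $x_j$, $j\ne i$. The cost of agent $i$ is $J_i(x_i,\boldsymbol x_{-i})=f_i(x_i,\boldsymbol x_{-i})+g_i(x_i)$. Each $g_i:\mathbb R^{n_i}\to(-\infty,\infty]$ is lower semicontinuous and convex, and $\Omega_i=\mathrm{dom}(g_i)$ is closed and convex; $\boldsymbol\Omega=\prod_i\Omega_i$. For all $\boldsymbol x_{-i}\in\mathbb R^{n-n_i}$, $f_i(\cdot,\boldsymbol x_{-i})$ is convex and continuously differentiable. Given $A_i\in\mathbb R^{m\times n_i}$, $b_i\in\mathbb R^m$, put $A=[A_1,\dots,A_N]$, $b=\sum_i b_i$. The collective feasible set $\{\boldsymbol x\in\boldsymbol\Omega: A\boldsymbol x\le b\}$ satisfies Slater's constraint qualification. Agent $i$ solves $\min_{x_i\in\Omega_i}J_i(x_i,\boldsymbol x_{-i})$ subject to $A_ix_i\le b-\sum_{j\ne i}A_jx_j$. Pseudo-gradient. $F(\boldsymbol x)=\mathrm{col}(\nabla_{x_1}f_1(\boldsymbol x),\dots,\nabla_{x_N}f_N(\boldsymbol x))$ is monotone on $\boldsymbol\Omega$, i.e. $\langle F(\boldsymbol x)-F(\boldsymbol y),\boldsymbol x-\boldsymbol y\rangle\ge0$ for all $\boldsymbol x,\boldsymbol y\in\boldsymbol\Omega$,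 and $\frac1\beta$-Lipschitz continuous there ($\beta>0$), i.e. $\|F(\boldsymbol x)-F(\boldsymbol y)\|\le\frac1\beta\|\boldsymbol x-\boldsymbol y\|$ for all $\boldsymbol x,\boldsymbol y\in\boldsymbol\Omega$. v-GNE. A collective strategy $\boldsymbol x^*$ is a v-GNE if it is a generalized Nash equilibrium (each $x_i^*$ solves agent $i$'s problem given $\boldsymbol x^*_{-i}$) with common dual variable: there is $\lambda^*\in\mathbb R^m_{\ge0}$, the same for all agents, such that, for all $i$, $0\in\nabla_{x_i}f_i(x_i^*,\boldsymbol x^*_{-i})+\partial g_i(x_i^* )+A_i^\top\lambda^*$ and $0\in \mathsf N_{\mathbb R^m_{\ge0}}(\lambda^* )-(A\boldsymbol x^*-b)$, where $\mathsf N$ denotes the normal cone. Communication graph. $\mathbf W=[w_{i,j}]\in\mathbb R^{N\times N}$ is a nonnegative weighted adjacency matrix, symmetric and irreducible; $\mathbf L=\mathrm{diag}\{(\mathbf W\mathbf 1_N)_1,\dots,(\mathbf W\mathbf 1_N)_N\}-\mathbf W$ is the Laplacian; $\kappa=|\mathbf L|$ ($|\cdot|$ is the spectral norm of a matrix); $\bar{\mathbf L}=\mathbf L\otimes I_m$. Operators on $\mathsf H=\mathbb R^n\times\mathbb R^{mN}\times\mathbb R^{mN}$. With $\mathbf A=\mathrm{diag}(A_1,\dots,A_N)$ (block diagonal), $\bar b=\mathrm{col}(b_1,\dots,b_N)$, $\boldsymbol z=\mathrm{col}(z_1,\dots,z_N)$, $\boldsymbol\lambda=\mathrm{col}(\lambda_1,\dots,\lambda_N)$,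 $z_i,\lambda_i\in\mathbb R^m$: $\mathcal A(\boldsymbol x,\boldsymbol z,\boldsymbol\lambda)=\mathrm{col}(F(\boldsymbol x),\mathbf 0,\bar{\mathbf L}\boldsymbol\lambda+\bar b)$, $\mathcal B(\boldsymbol x,\boldsymbol z,\boldsymbol\lambda)=\mathrm{col}(\mathbf A^\top\boldsymbol\lambda,\bar{\mathbf L}\boldsymbol\lambda,-\mathbf A\boldsymbol x-\bar{\mathbf L}\boldsymbol z)$, $\mathcal D=\mathcal A+\mathcal B$, $\mathcal C(\boldsymbol x,\boldsymbol z,\boldsymbol\lambda)=\big(\partial g_1(x_1)\times\cdots\times\partial g_N(x_N)\big)\times\{\mathbf 0_{mN}\}\times \mathsf N_{\mathbb R^{mN}_{\ge0}}(\boldsymbol\lambda)$. For an operator $T$, $\mathrm{zer}\,T=\{u:0\in Tu\}$. Constants. $L_{\mathcal A}=\frac1\beta+\kappa$, $L_{\mathcal B}=2|\mathbf A|+2\kappa$, $L_{\mathcal D}=L_{\mathcal A}+L_{\mathcal B}$. Step sizes. $\rho_i,\sigma_i,\tau_i>0$; $\rho=\mathrm{diag}\{\rho_1I_{n_1},\dots,\rho_NI_{n_N}\}$, $\sigma=\mathrm{diag}\{\sigma_1I_m,\dots,\sigma_NI_m\}$, $\tau=\mathrm{diag}\{\tau_1I_m,\dots,\tau_NI_m\}$, $\Psi=\mathrm{diag}(\rho^{-1},\sigma^{-1},\tau^{-1})$. $J_{\Psi^{-1}\mathcal C}=(\mathrm{Id}+\Psi^{-1}\mathcal C)^{-1}$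 is the resolvent: it acts as $(\mathrm{Id}+\rho_i\partial g_i)^{-1}$ on the $x_i$ components, the identity on $\boldsymbol z$, and the projection onto $\mathbb R^{mN}_{\ge0}$ on $\boldsymbol\lambda$.
   Formalization: Two hypotheses are added, without which the claim fails: a v-GNE of the game exists, and the bound |F(x)-F(y)| <= (1/β)|x-y| also holds for x outside Ω and y in Ω, since the iterates x^k may leave Ω. *)

theory Defs
  imports "HOL-Analysis.Analysis" "HOL-Library.Set_Algebras"
begin

(*
  Conventions.  The agents are the elements of a finite type 'i (so N = CARD('i)).
  The n coordinates of a collective strategy x :: real^'d are indexed by a finite type 'd,
  and own :: 'd => 'i says which agent a coordinate belongs to, so that agent i has
  n_i = card {c. own c = i} coordinates.  The space R^(n_i) is the coordinate subspace
  strat own i of real^'d; hence x_i = blk own i x, and x is the sum of its blocks.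
  Vectors of R^(mN) are of type real^('i * 'm); the entry (i,r) is the r-th entry of block i.
*)

section \<open>Block structure\<close>

definition strat :: "('d::finite \<Rightarrow> 'i) \<Rightarrow> 'i \<Rightarrow> (real^'d) set" where
  "strat own i = {y. \<forall>c. own c \<noteq> i \<longrightarrow> y $ c = 0}"

definition blk :: "('d::finite \<Rightarrow> 'i) \<Rightarrow> 'i \<Rightarrow> real^'d \<Rightarrow> real^'d" where
  "blk own i x = (\<chi> c. if own c = i then x $ c else 0)"

text \<open>The collective strategy \<open>(y\<^sub>i, x\<^sub>-\<^sub>i)\<close>.\<close>

definition join :: "('d::finite \<Rightarrow> 'i) \<Rightarrow> 'i \<Rightarrow> real^'d \<Rightarrow> real^'d \<Rightarrow> real^'d" where
  "join own i y x = (\<chi> c. if own c = i then y $ c else x $ c)"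

text \<open>The matrix \<open>A = [A\<^sub>1, \<dots>, A\<^sub>N]\<close> is the datum; \<open>Ablk own A i\<close> is \<open>A\<^sub>i\<close>, acting on the
  coordinate subspace of agent \<open>i\<close>, and \<open>Adiag own A\<close> is \<open>diag(A\<^sub>1, \<dots>, A\<^sub>N)\<close>.\<close>

definition Ablk :: "('d::finite \<Rightarrow> 'i) \<Rightarrow> real^'d^'m \<Rightarrow> 'i \<Rightarrow> real^'d^'m::finite" where
  "Ablk own A i = (\<chi> r c. if own c = i then A $ r $ c else 0)"

definition Adiag :: "('d::finite \<Rightarrow> 'i::finite) \<Rightarrow> real^'d^'m::finite \<Rightarrow> real^'d^('i \<times> 'm)" where
  "Adiag own A = (\<chi> p c. if own c = fst p then A $ snd p $ c else 0)"

definition bcol :: "('i::finite \<Rightarrow> real^'m::finite) \<Rightarrow> real^('i \<times> 'm)" where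
  "bcol bs = (\<chi> p. bs (fst p) $ snd p)"

definition bsum :: "('i::finite \<Rightarrow> real^'m::finite) \<Rightarrow> real^'m" where
  "bsum bs = (\<Sum>i\<in>UNIV. bs i)"

section \<open>Convex analysis\<close>

text \<open>Extended-valued functions are considered on a subspace \<open>S\<close>; their values outside \<open>S\<close>
  are irrelevant.\<close>

definition edom :: "'a set \<Rightarrow> ('a \<Rightarrow> ereal) \<Rightarrow> 'a set" where
  "edom S \<phi> = {y \<in> S. \<phi> y < \<infinity>}"

definition lsc_fun :: "'a::topological_space set \<Rightarrow> ('a \<Rightarrow> ereal) \<Rightarrow> bool" where
  "lsc_fun S \<phi> \<longleftrightarrow> (\<forall>y\<in>S. \<phi> y \<le> Liminf (at y within S) \<phi>)"

definition econvex :: "'a::real_vector set \<Rightarrow> ('a \<Rightarrow> ereal) \<Rightarrow> bool" where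
  "econvex S \<phi> \<longleftrightarrow> (\<forall>y\<in>S. \<forall>w\<in>S. \<forall>t. 0 < t \<and> t < 1 \<longrightarrow>
     \<phi> ((1 - t) *\<^sub>R y + t *\<^sub>R w) \<le> ereal (1 - t) * \<phi> y + ereal t * \<phi> w)"

definition subdifferential :: "'a::real_inner set \<Rightarrow> ('a \<Rightarrow> ereal) \<Rightarrow> 'a \<Rightarrow> 'a set" where
  "subdifferential S \<phi> y = {s \<in> S. \<forall>w\<in>S. \<phi> y + ereal (s \<bullet> (w - y)) \<le> \<phi> w}"

definition normal_cone :: "'a::real_inner set \<Rightarrow> 'a \<Rightarrow> 'a set" where
  "normal_cone K x = (if x \<in> K then {v. \<forall>y\<in>K. v \<bullet> (y - x) \<le> 0} else {})"

definition zer :: "('a \<Rightarrow> 'a::zero set) \<Rightarrow> 'a set" where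
  "zer T = {u. 0 \<in> T u}"

text \<open>The set-valued operator \<open>(Id + P \<circ> C)\<inverse>\<close>, for a map \<open>P\<close> and a set-valued \<open>C\<close>.\<close>

definition resolvent :: "('a \<Rightarrow> 'a) \<Rightarrow> ('a \<Rightarrow> 'a set) \<Rightarrow> 'a::plus \<Rightarrow> 'a set" where
  "resolvent P C w = {u. w \<in> {u} + P ` C u}"

section \<open>The game\<close>

text \<open>Composing with the coordinate projection onto \<open>R^(n\<^sub>i)\<close> turns \<open>f\<^sub>i(\<cdot>, x\<^sub>-\<^sub>i)\<close> into a
  function on \<open>R^n\<close> whose gradient is the partial gradient, padded with zeros.\<close>

definition pgrad :: "('d::finite \<Rightarrow> 'i) \<Rightarrow> ('i \<Rightarrow> real^'d \<Rightarrow> real) \<Rightarrow> 'i \<Rightarrow> real^'d \<Rightarrow> real^'d" where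
  "pgrad own f i x = (THE D. GDERIV (\<lambda>y. f i (join own i y x)) x :> D)"

definition C1_own :: "('d::finite \<Rightarrow> 'i) \<Rightarrow> ('i \<Rightarrow> real^'d \<Rightarrow> real) \<Rightarrow> 'i \<Rightarrow> real^'d \<Rightarrow> bool" where
  "C1_own own f i x \<longleftrightarrow> (\<exists>G. continuous_on UNIV G \<and>
     (\<forall>y. GDERIV (\<lambda>y. f i (join own i y x)) y :> G y))"

definition pseudograd :: "('d::finite \<Rightarrow> 'i) \<Rightarrow> ('i \<Rightarrow> real^'d \<Rightarrow> real) \<Rightarrow> real^'d \<Rightarrow> real^'d" where
  "pseudograd own f x = (\<chi> c. pgrad own f (own c) x $ c)"

definition Omega_i :: "('d::finite \<Rightarrow> 'i) \<Rightarrow> ('i \<Rightarrow> real^'d \<Rightarrow> ereal) \<Rightarrow> 'i \<Rightarrow> (real^'d) set" where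
  "Omega_i own g i = edom (strat own i) (g i)"

definition Omega :: "('d::finite \<Rightarrow> 'i) \<Rightarrow> ('i \<Rightarrow> real^'d \<Rightarrow> ereal) \<Rightarrow> (real^'d) set" where
  "Omega own g = {x. \<forall>i. blk own i x \<in> Omega_i own g i}"

definition slater :: "('d::finite \<Rightarrow> 'i::finite) \<Rightarrow> ('i \<Rightarrow> real^'d \<Rightarrow> ereal) \<Rightarrow>
    real^'d^'m::finite \<Rightarrow> ('i \<Rightarrow> real^'m) \<Rightarrow> bool" where
  "slater own g A bs \<longleftrightarrow> (\<exists>x \<in> rel_interior (Omega own g). \<forall>r. (A *v x) $ r < bsum bs $ r)"

definition cost :: "('d::finite \<Rightarrow> 'i) \<Rightarrow> ('i \<Rightarrow> real^'d \<Rightarrow> real) \<Rightarrow> ('i \<Rightarrow> real^'d \<Rightarrow> ereal) \<Rightarrow>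
    'i \<Rightarrow> real^'d \<Rightarrow> real^'d \<Rightarrow> ereal" where
  "cost own f g i y x = ereal (f i (join own i y x)) + g i y"

definition feasible_i :: "('d::finite \<Rightarrow> 'i::finite) \<Rightarrow> ('i \<Rightarrow> real^'d \<Rightarrow> ereal) \<Rightarrow>
    real^'d^'m::finite \<Rightarrow> ('i \<Rightarrow> real^'m) \<Rightarrow> 'i \<Rightarrow> real^'d \<Rightarrow> (real^'d) set" where
  "feasible_i own g A bs i x = {y \<in> Omega_i own g i.
     Ablk own A i *v y \<le> bsum bs - (\<Sum>j\<in>UNIV - {i}. Ablk own A j *v blk own j x)}"

definition is_GNE :: "('d::finite \<Rightarrow> 'i::finite) \<Rightarrow> ('i \<Rightarrow> real^'d \<Rightarrow> real) \<Rightarrow>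
    ('i \<Rightarrow> real^'d \<Rightarrow> ereal) \<Rightarrow> real^'d^'m::finite \<Rightarrow> ('i \<Rightarrow> real^'m) \<Rightarrow> real^'d \<Rightarrow> bool" where
  "is_GNE own f g A bs x \<longleftrightarrow> (\<forall>i. blk own i x \<in> feasible_i own g A bs i x \<and>
     (\<forall>y \<in> feasible_i own g A bs i x. cost own f g i (blk own i x) x \<le> cost own f g i y x))"

definition is_vGNE :: "('d::finite \<Rightarrow> 'i::finite) \<Rightarrow> ('i \<Rightarrow> real^'d \<Rightarrow> real) \<Rightarrow>
    ('i \<Rightarrow> real^'d \<Rightarrow> ereal) \<Rightarrow> real^'d^'m::finite \<Rightarrow> ('i \<Rightarrow> real^'m) \<Rightarrow> real^'d \<Rightarrow> bool" where
  "is_vGNE own f g A bs x \<longleftrightarrow> is_GNE own f g A bs x \<and>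
     (\<exists>l. 0 \<le> l \<and>
       (\<forall>i. 0 \<in> {pgrad own f i x} + subdifferential (strat own i) (g i) (blk own i x)
                 + {transpose (Ablk own A i) *v l}) \<and>
       0 \<in> normal_cone {l. 0 \<le> l} l + {- (A *v x - bsum bs)})"

section \<open>The communication graph\<close>

definition irreducible_mat :: "real^'i^'i::finite \<Rightarrow> bool" where
  "irreducible_mat W \<longleftrightarrow> \<not> (\<exists>S. S \<noteq> {} \<and> S \<noteq> UNIV \<and> (\<forall>i\<in>S. \<forall>j\<in>- S. W $ i $ j = 0))"

definition laplacian :: "real^'i^'i::finite \<Rightarrow> real^'i^'i" where
  "laplacian W = (\<chi> i j. if i = j then (W *v 1) $ i else 0) - W"

definition kron :: "real^'a^'b \<Rightarrow> real^'c^'e \<Rightarrow> real^('a::finite \<times> 'c::finite)^('b::finite \<times> 'e::finite)" where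
  "kron M K = (\<chi> p q. M $ fst p $ fst q * K $ snd p $ snd q)"

definition Lbar :: "real^'i^'i::finite \<Rightarrow> real^('i \<times> 'm)^('i \<times> 'm::finite)" where
  "Lbar W = kron (laplacian W) (mat 1 :: real^'m^'m)"

definition spec_norm :: "real^'a^'b \<Rightarrow> real" where
  "spec_norm M = onorm (\<lambda>x. M *v x)"

section \<open>Operators, constants and step sizes\<close>

type_synonym ('i, 'd, 'm) H = "(real^'d) \<times> (real^('i \<times> 'm)) \<times> (real^('i \<times> 'm))"

definition opA :: "('d::finite \<Rightarrow> 'i::finite) \<Rightarrow> ('i \<Rightarrow> real^'d \<Rightarrow> real) \<Rightarrow> ('i \<Rightarrow> real^'m) \<Rightarrow>
    real^'i^'i \<Rightarrow> ('i, 'd, 'm::finite) H \<Rightarrow> ('i, 'd, 'm) H" where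
  "opA own f bs W = (\<lambda>(x, z, l). (pseudograd own f x, 0, Lbar W *v l + bcol bs))"

definition opB :: "('d::finite \<Rightarrow> 'i::finite) \<Rightarrow> real^'d^'m \<Rightarrow>
    real^'i^'i \<Rightarrow> ('i, 'd, 'm::finite) H \<Rightarrow> ('i, 'd, 'm) H" where
  "opB own A W = (\<lambda>(x, z, l).
     (transpose (Adiag own A) *v l, Lbar W *v l, - (Adiag own A *v x) - Lbar W *v z))"

definition opD :: "('d::finite \<Rightarrow> 'i::finite) \<Rightarrow> ('i \<Rightarrow> real^'d \<Rightarrow> real) \<Rightarrow> real^'d^'m \<Rightarrow>
    ('i \<Rightarrow> real^'m) \<Rightarrow> real^'i^'i \<Rightarrow> ('i, 'd, 'm::finite) H \<Rightarrow> ('i, 'd, 'm) H" where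
  "opD own f A bs W v = opA own f bs W v + opB own A W v"

definition opC :: "('d::finite \<Rightarrow> 'i::finite) \<Rightarrow> ('i \<Rightarrow> real^'d \<Rightarrow> ereal) \<Rightarrow>
    ('i, 'd, 'm::finite) H \<Rightarrow> ('i, 'd, 'm) H set" where
  "opC own g = (\<lambda>(x, z, l).
     {s. \<forall>i. blk own i s \<in> subdifferential (strat own i) (g i) (blk own i x)}
     \<times> {0} \<times> normal_cone {l. 0 \<le> l} l)"

text \<open>In the constants, \<open>\<beta>\<close> is the reciprocal of the Lipschitz constant of the pseudo-gradient.\<close>

definition LipA :: "real \<Rightarrow> real^'i^'i::finite \<Rightarrow> real" where
  "LipA \<beta> W = 1 / \<beta> + spec_norm (laplacian W)"

definition LipB :: "('d::finite \<Rightarrow> 'i::finite) \<Rightarrow> real^'d^'m::finite \<Rightarrow> real^'i^'i \<Rightarrow> real" where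
  "LipB own A W = 2 * spec_norm (Adiag own A) + 2 * spec_norm (laplacian W)"

definition LipD :: "('d::finite \<Rightarrow> 'i::finite) \<Rightarrow> real \<Rightarrow> real^'d^'m::finite \<Rightarrow> real^'i^'i \<Rightarrow> real" where
  "LipD own \<beta> A W = LipA \<beta> W + LipB own A W"

definition Psi :: "('d::finite \<Rightarrow> 'i::finite) \<Rightarrow> ('i \<Rightarrow> real) \<Rightarrow> ('i \<Rightarrow> real) \<Rightarrow> ('i \<Rightarrow> real) \<Rightarrow>
    ('i, 'd, 'm::finite) H \<Rightarrow> ('i, 'd, 'm) H" where
  "Psi own \<rho> \<sigma> \<tau> = (\<lambda>(x, z, l).
     (\<chi> c. inverse (\<rho> (own c)) * x $ c,
      \<chi> p. inverse (\<sigma> (fst p)) * z $ p,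
      \<chi> p. inverse (\<tau> (fst p)) * l $ p))"

end

theory Submission
  imports Defs
begin

text \<open>
The iteration is Tseng's forward-backward-forward method for the inclusion \<open>0 \<in> D v + C v\<close> with
\<open>D = opD\<close> and \<open>C = opC\<close>, run in the metric of \<open>\<Psi>\<close>. If \<open>s\<close> is a zero, monotonicity makes the
squared \<open>\<Psi>\<close>-distance of \<open>v k\<close> to \<open>s\<close> drop in each step by at least
\<open>1 - (|\<Psi>\<^sup>-\<^sup>1| L)\<^sup>2\<close> times the squared \<open>\<Psi>\<close>-distance of \<open>v k\<close> and \<open>u k\<close>, where \<open>L\<close> is the
Lipschitz constant of \<open>D\<close> (\<open>fbf_step_decrease\<close>); the step size condition makes this factor positive. So the
iterates are bounded and \<open>v k - u k\<close> tends to zero. The inclusion that defines \<open>u k\<close> then passes to the limit along a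
convergent subsequence, because the graph of \<open>C\<close> is closed and \<open>D\<close> is continuous at points of the domain of \<open>C\<close>.
Every cluster point is thus a zero, and since the distance to it decreases, the whole sequence converges to it
(\<open>fbf_converges\<close>).

The hypotheses of this abstract result are monotonicity and closedness of subdifferentials and normal cones
(\<open>monotone_opC\<close>, \<open>closed_graph_opC\<close>), and monotonicity and the Lipschitz bound of \<open>D\<close>
(\<open>opD_monotone\<close>, \<open>opD_lipschitz\<close>). The latter two rest on the pseudo-gradient, on the skewness of \<open>opB\<close> and on
the fact that the Laplacian has a nonnegative quadratic form.

Zeros correspond to variational equilibria through the kernel and the range of the Laplacian of a connected graph. Its
kernel consists of the constant vectors, so at a zero all local multipliers coincide and the equations of the agents add up
to the KKT system (\<open>zero_imp_KKT\<close>), which by convexity implies the equilibrium property (\<open>KKT_imp_GNE\<close>).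
Its range consists of the vectors of sum zero, so the KKT system of an equilibrium can be completed by some \<open>z\<close> to a
zero (\<open>KKT_imp_zero\<close>); this supplies the zero \<open>s\<close> with which the argument starts.
\<close>

section \<open>Tseng's method in a variable metric\<close>

definition monotone_op :: "('a::real_inner \<Rightarrow> 'a set) \<Rightarrow> bool" where
  "monotone_op C \<longleftrightarrow> (\<forall>x y. \<forall>a\<in>C x. \<forall>b\<in>C y. 0 \<le> (a - b) \<bullet> (x - y))"

text \<open>For \<open>Q = P\<^sup>-\<^sup>1\<close>, the smallest eigenvalue of \<open>Q\<close> is \<open>1 / |P|\<close>. This constant
carries the Euclidean Lipschitz estimate of the forward operator over to the metric of \<open>Q\<close>.\<close>

lemma onorm_inverse_le_quadratic_form:
  fixes P Q :: "'a::euclidean_space \<Rightarrow> 'a"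
  assumes P: "linear P" and PQ: "\<And>x. P (Q x) = x"
    and sym: "\<And>x y. P x \<bullet> y = x \<bullet> P y" and nonneg: "\<And>x. 0 \<le> P x \<bullet> x"
  shows "(norm w)\<^sup>2 \<le> onorm P * (Q w \<bullet> w)"
proof -
  interpret P: linear P by (fact P)
  have bl: "bounded_linear P" using P by (simp add: linear_conv_bounded_linear)
  let ?a = "onorm P" and ?y = "Q w"
  have Py: "P ?y = w" by (rule PQ)
  have quad: "P w \<bullet> w \<le> ?a * (norm w)\<^sup>2"
  proof -
    have "P w \<bullet> w \<le> norm (P w) * norm w" by (rule norm_cauchy_schwarz)
    also have "\<dots> \<le> (?a * norm w) * norm w" by (intro mult_right_mono onorm bl) auto
    finally show ?thesis by (simp add: power2_eq_square mult.assoc)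
  qed
  show ?thesis
  proof (cases "?a = 0")
    case True
    then have "norm w \<le> 0" using onorm[OF bl, of ?y] Py by simp
    then show ?thesis by simp
  next
    case False
    then have a: "?a > 0" using onorm_pos_le[OF bl] by simp
    \<comment> \<open>Nonnegativity of the form of \<open>P\<close> at \<open>Q w - w / |P|\<close> becomes the claim once \<open>quad\<close> is inserted.\<close>
    have "0 \<le> P (?y - (1 / ?a) *\<^sub>R w) \<bullet> (?y - (1 / ?a) *\<^sub>R w)" by (rule nonneg)
    also have "\<dots> = ?y \<bullet> w - 2 / ?a * (norm w)\<^sup>2 + (1 / ?a)\<^sup>2 * (P w \<bullet> w)"
      using sym[of w ?y]
      by (simp add: P.diff P.scaleR Py inner_diff inner_commute[of w ?y] dot_square_norm
          algebra_simps power2_eq_square)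
    also have "\<dots> \<le> ?y \<bullet> w - 2 / ?a * (norm w)\<^sup>2 + (1 / ?a)\<^sup>2 * (?a * (norm w)\<^sup>2)"
      by (intro add_left_mono mult_left_mono quad) simp
    also have "\<dots> = ?y \<bullet> w - (norm w)\<^sup>2 / ?a"
      using a by (simp add: field_simps power2_eq_square)
    finally show ?thesis using a by (simp add: field_simps)
  qed
qed

text \<open>The Fejer inequality. In the metric of \<open>Q\<close> the step from \<open>p\<close> to \<open>p'\<close> is \<open>Q (p - p') = c + D q\<close>
with \<open>c \<in> C q\<close>: an element of \<open>(D + C) q\<close>. Monotonicity compares it with \<open>0 \<in> (D + C) s\<close>,
so \<open>Q (p - p')\<close> points away from \<open>s\<close> at \<open>q\<close>. The only loss is \<open>p' - q = P (D p - D q)\<close>, which the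
Lipschitz bound makes shorter than \<open>p - q\<close> by the factor \<open>|P| L\<close>.\<close>

lemma fbf_step_decrease:
  fixes P Q D :: "'a::euclidean_space \<Rightarrow> 'a"
  assumes P: "linear P" and Q: "linear Q"
    and PQ: "\<And>x. P (Q x) = x" and QP: "\<And>x. Q (P x) = x"
    and sym: "\<And>x y. Q x \<bullet> y = x \<bullet> Q y" and nonneg: "\<And>x. 0 \<le> Q x \<bullet> x"
    and C_mono: "monotone_op C" and D_mono: "0 \<le> (D q - D s) \<bullet> (q - s)"
    and zero: "- D s \<in> C s"
    and lip: "norm (D p - D q) \<le> L * norm (p - q)"
    and q: "Q (p - q) - D p \<in> C q"
    and p': "p' = q + P (D p - D q)"
  shows "Q (p' - s) \<bullet> (p' - s)
    \<le> Q (p - s) \<bullet> (p - s) - (1 - (onorm P * L)\<^sup>2) * (Q (p - q) \<bullet> (p - q))"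
proof -
  interpret P: linear P by (fact P)
  interpret Q: linear Q by (fact Q)
  have bl: "bounded_linear P" using P by (simp add: linear_conv_bounded_linear)
  have symP: "P x \<bullet> y = x \<bullet> P y" for x y using sym[of "P x" "P y"] by (simp add: QP)
  have nonnegP: "0 \<le> P x \<bullet> x" for x
    using nonneg[of "P x"] by (simp add: QP inner_commute)
  have "0 \<le> ((Q (p - q) - D p) - (- D s)) \<bullet> (q - s)"
    using C_mono q zero unfolding monotone_op_def by blast
  then have "0 \<le> (Q (p - q) - (D p - D q)) \<bullet> (q - s)"
    using D_mono by (simp add: inner_diff inner_add algebra_simps)
  also have "Q (p - q) - (D p - D q) = Q (p - p')"
    by (simp add: p' Q.diff Q.add QP algebra_simps)
  finally have corr: "0 \<le> Q (p - p') \<bullet> (q - s)" .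
  \<comment> \<open>Expand the form at \<open>p - s = (p - p') + (p' - q) + (q - s)\<close>.\<close>
  have "Q (p - s) \<bullet> (p - s) - Q (p' - s) \<bullet> (p' - s)
      = Q (p - q) \<bullet> (p - q) - Q (p' - q) \<bullet> (p' - q) + 2 * (Q (p - p') \<bullet> (q - s))"
    using sym[of p q] sym[of p s] sym[of p p'] sym[of q s] sym[of q p'] sym[of s p']
    by (simp add: Q.diff inner_diff inner_commute algebra_simps)
  then have gain: "Q (p' - s) \<bullet> (p' - s)
      \<le> Q (p - s) \<bullet> (p - s) - Q (p - q) \<bullet> (p - q) + Q (p' - q) \<bullet> (p' - q)"
    using corr by linarith
  let ?a = "onorm P" and ?d = "D p - D q"
  have a: "0 \<le> ?a" by (rule onorm_pos_le[OF bl])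
  have "Q (p' - q) \<bullet> (p' - q) = ?d \<bullet> P ?d" by (simp add: p' QP)
  also have "\<dots> \<le> norm ?d * norm (P ?d)" by (rule norm_cauchy_schwarz)
  also have "\<dots> \<le> norm ?d * (?a * norm ?d)" by (intro mult_left_mono onorm bl) auto
  also have "\<dots> = ?a * (norm ?d)\<^sup>2" by (simp add: power2_eq_square)
  also have "\<dots> \<le> ?a * (L * norm (p - q))\<^sup>2"
    by (intro mult_left_mono power_mono lip a) auto
  also have "\<dots> = ?a * L\<^sup>2 * (norm (p - q))\<^sup>2" by (simp add: power_mult_distrib)
  also have "\<dots> \<le> ?a * L\<^sup>2 * (?a * (Q (p - q) \<bullet> (p - q)))"
    by (intro mult_left_mono onorm_inverse_le_quadratic_form[OF P PQ symP nonnegP]) (simp add: a)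
  finally have "Q (p' - q) \<bullet> (p' - q) \<le> (?a * L)\<^sup>2 * (Q (p - q) \<bullet> (p - q))"
    by (simp add: power2_eq_square mult_ac)
  then show ?thesis using gain by (simp add: left_diff_distrib)
qed

text \<open>The set \<open>X\<close> plays the role of a closed set containing the domain of \<open>C\<close>. The backward points \<open>u k\<close>
and all zeros lie in it, whereas the points \<open>v k\<close> may leave it; monotonicity of \<open>D\<close> is therefore asked for
inside \<open>X\<close> only, and the Lipschitz bound between an arbitrary point and a point of \<open>X\<close>. Closedness
of \<open>X\<close> puts the limits of subsequences into \<open>X\<close>, where the Lipschitz bound gives continuity of \<open>D\<close>.\<close>

theorem fbf_converges:
  fixes P Q D :: "'a::euclidean_space \<Rightarrow> 'a" and u v :: "nat \<Rightarrow> 'a"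
  assumes P: "linear P" and Q: "linear Q"
    and PQ: "\<And>x. P (Q x) = x" and QP: "\<And>x. Q (P x) = x"
    and sym: "\<And>x y. Q x \<bullet> y = x \<bullet> Q y" and nonneg: "\<And>x. 0 \<le> Q x \<bullet> x"
    and C_mono: "monotone_op C" and C_graph: "closed {(x, a). a \<in> C x}"
    and X: "closed X" "\<And>x. C x \<noteq> {} \<Longrightarrow> x \<in> X"
    and D_mono: "\<And>x y. x \<in> X \<Longrightarrow> y \<in> X \<Longrightarrow> 0 \<le> (D x - D y) \<bullet> (x - y)"
    and lip: "\<And>x y. y \<in> X \<Longrightarrow> norm (D x - D y) \<le> L * norm (x - y)"
    and L: "L > 0" and step: "onorm P * L < 1"
    and zero: "- D s0 \<in> C s0"
    and u: "\<And>k. Q (v k - u k) - D (v k) \<in> C (u k)"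
    and v: "\<And>k. v (Suc k) = u k + P (D (v k) - D (u k))"
  shows "\<exists>s. - D s \<in> C s \<and> v \<longlonglongrightarrow> s"
proof -
  interpret Q: linear Q by (fact Q)
  have symP: "P x \<bullet> y = x \<bullet> P y" for x y using sym[of "P x" "P y"] by (simp add: QP)
  have nonnegP: "0 \<le> P x \<bullet> x" for x
    using nonneg[of "P x"] by (simp add: QP inner_commute)
  define a where "a = onorm P"
  define N where "N w = Q w \<bullet> w" for w
  define c where "c = 1 - (a * L)\<^sup>2"
  have a: "0 \<le> a"
    unfolding a_def using P by (intro onorm_pos_le) (simp add: linear_conv_bounded_linear)
  have coercive: "(norm w)\<^sup>2 \<le> a * N w" for w
    unfolding a_def N_def by (rule onorm_inverse_le_quadratic_form[OF P PQ symP nonnegP])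
  have N0: "0 \<le> N w" for w unfolding N_def by (rule nonneg)
  have "0 \<le> a * L" using a L by simp
  then have "(a * L)\<^sup>2 < 1" using step by (simp add: a_def power_less_one_iff)
  then have c: "c > 0" by (simp add: c_def)
  have contQ: "continuous_on UNIV Q"
    by (rule linear_continuous_on) (simp add: Q flip: linear_conv_bounded_linear)
  have uX: "u k \<in> X" for k using u[of k] X(2) by blast
  have decr: "N (v (Suc k) - s) \<le> N (v k - s) - c * N (v k - u k)" if s: "- D s \<in> C s" for s k
  proof -
    have "s \<in> X" using s X(2) by blast
    then show ?thesis
      unfolding N_def c_def a_def
      by (intro fbf_step_decrease[OF P Q PQ QP sym nonneg C_mono _ s _ u v] D_mono lip uX)
  qed
  have mono: "decseq (\<lambda>k. N (v k - s))" if s: "- D s \<in> C s" for s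
  proof (rule decseq_SucI)
    fix k
    have "0 \<le> c * N (v k - u k)" using c N0 by simp
    then show "N (v (Suc k) - s) \<le> N (v k - s)" using decr[OF s, of k] by linarith
  qed

  \<comment> \<open>The decrements of a nonnegative decreasing sequence tend to zero.\<close>
  have N_vu: "(\<lambda>k. N (v k - u k)) \<longlonglongrightarrow> 0"
  proof -
    obtain l where l: "(\<lambda>k. N (v k - s0)) \<longlonglongrightarrow> l"
      using decseq_convergent[OF mono[OF zero], of 0] N0 by blast
    have "(\<lambda>k. (N (v k - s0) - N (v (Suc k) - s0)) / c) \<longlonglongrightarrow> (l - l) / c"
      using c by (intro tendsto_intros l LIMSEQ_Suc[OF l]) auto
    then have lim: "(\<lambda>k. (N (v k - s0) - N (v (Suc k) - s0)) / c) \<longlonglongrightarrow> 0" by simp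
    show ?thesis
    proof (rule tendsto_sandwich[OF _ _ tendsto_const lim])
      show "\<forall>\<^sub>F k in sequentially. N (v k - u k) \<le> (N (v k - s0) - N (v (Suc k) - s0)) / c"
        using decr[OF zero] c
        by (intro always_eventually allI) (simp add: pos_le_divide_eq mult.commute algebra_simps)
    qed (simp add: N0)
  qed
  have N_lim: "w \<longlonglongrightarrow> 0" if "(\<lambda>k. N (w k)) \<longlonglongrightarrow> 0" for w :: "nat \<Rightarrow> 'a"
  proof -
    have "(\<lambda>k. a * N (w k)) \<longlonglongrightarrow> 0" using tendsto_mult_right_zero[OF that] .
    then have "(\<lambda>k. (norm (w k))\<^sup>2) \<longlonglongrightarrow> 0"
      by (rule tendsto_sandwich[OF _ _ tendsto_const, rotated 2]) (simp_all add: coercive)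
    then have "(\<lambda>k. sqrt ((norm (w k))\<^sup>2)) \<longlonglongrightarrow> sqrt 0" by (intro tendsto_intros)
    then show ?thesis by (simp add: tendsto_norm_zero_iff)
  qed
  have vu: "(\<lambda>k. v k - u k) \<longlonglongrightarrow> 0" by (rule N_lim[OF N_vu])

  \<comment> \<open>A cluster point of the iterates exists and is a zero, because the graph of \<open>C\<close> is closed.\<close>
  have "bounded (range v)"
  proof -
    have "norm (v k) \<le> sqrt (a * N (v 0 - s0)) + norm s0" for k
    proof -
      have "(norm (v k - s0))\<^sup>2 \<le> a * N (v k - s0)" by (rule coercive)
      also have "\<dots> \<le> a * N (v 0 - s0)"
        using decseqD[OF mono[OF zero], of 0 k] a by (intro mult_left_mono) auto
      finally have "norm (v k - s0) \<le> sqrt (a * N (v 0 - s0))" by (rule real_le_rsqrt)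
      then show ?thesis using norm_triangle_sub[of "v k" s0] by linarith
    qed
    then show ?thesis by (auto simp: bounded_iff)
  qed
  then obtain s r where r: "strict_mono r" and vr: "(v \<circ> r) \<longlonglongrightarrow> s"
    using bounded_imp_convergent_subsequence by blast
  have vur: "(\<lambda>k. v (r k) - u (r k)) \<longlonglongrightarrow> 0"
    using LIMSEQ_subseq_LIMSEQ[OF vu r] by (simp add: o_def)
  have vr': "(\<lambda>k. v (r k)) \<longlonglongrightarrow> s" using vr by (simp add: o_def)
  have ur: "(\<lambda>k. u (r k)) \<longlonglongrightarrow> s" using tendsto_diff[OF vr' vur] by simp
  have sX: "s \<in> X" using closed_sequentially[OF X(1) _ ur] uX by blast
  have Dvr: "(\<lambda>k. D (v (r k))) \<longlonglongrightarrow> D s"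
  proof -
    have "(\<lambda>k. L * norm (v (r k) - s)) \<longlonglongrightarrow> L * norm (s - s)" by (intro tendsto_intros vr')
    then have "(\<lambda>k. L * norm (v (r k) - s)) \<longlonglongrightarrow> 0" by simp
    then have "(\<lambda>k. D (v (r k)) - D s) \<longlonglongrightarrow> 0"
      by (rule Lim_null_comparison[rotated]) (simp add: lip sX)
    then show ?thesis by (simp add: LIM_zero_iff)
  qed
  have "(\<lambda>k. Q (v (r k) - u (r k))) \<longlonglongrightarrow> Q 0"
    by (rule continuous_on_tendsto_compose[OF contQ vur]) auto
  then have "(\<lambda>k. Q (v (r k) - u (r k)) - D (v (r k))) \<longlonglongrightarrow> 0 - D s"
    by (intro tendsto_diff Dvr) simp
  then have "(\<lambda>k. (u (r k), Q (v (r k) - u (r k)) - D (v (r k)))) \<longlonglongrightarrow> (s, - D s)"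
    by (intro tendsto_Pair ur) simp
  then have "(s, - D s) \<in> {(x, a). a \<in> C x}"
    by (rule closed_sequentially[OF C_graph, rotated]) (simp add: u)
  then have s: "- D s \<in> C s" by simp

  \<comment> \<open>The distances to \<open>s\<close> itself decrease, and along \<open>r\<close> they tend to zero.\<close>
  obtain l where l: "(\<lambda>k. N (v k - s)) \<longlonglongrightarrow> l"
    using decseq_convergent[OF mono[OF s], of 0] N0 by blast
  have "(\<lambda>k. v (r k) - s) \<longlonglongrightarrow> 0" using tendsto_diff[OF vr' tendsto_const[of s]] by simp
  then have "(\<lambda>k. N (v (r k) - s)) \<longlonglongrightarrow> Q 0 \<bullet> 0"
    unfolding N_def by (intro tendsto_inner continuous_on_tendsto_compose[OF contQ]) auto
  moreover have "(\<lambda>k. N (v (r k) - s)) \<longlonglongrightarrow> l"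
    using LIMSEQ_subseq_LIMSEQ[OF l r] by (simp add: o_def)
  ultimately have "l = 0" using LIMSEQ_unique by fastforce
  then have "(\<lambda>k. v k - s) \<longlonglongrightarrow> 0" using N_lim l by simp
  then have "v \<longlonglongrightarrow> s" by (simp add: LIM_zero_iff)
  then show ?thesis using s by blast
qed

section \<open>Subdifferentials and normal cones\<close>

lemma set_plus_singleton_iff: "(x :: 'a::ab_group_add) \<in> {a} + S \<longleftrightarrow> x - a \<in> S"
  by (auto simp: set_plus_def intro!: exI[of _ "x - a"] bexI[of _ "x - a"])

lemma subdifferential_edom:
  assumes "s \<in> subdifferential S \<phi> y" "y \<in> S" "edom S \<phi> \<noteq> {}"
  shows "y \<in> edom S \<phi>"
proof (rule ccontr)
  assume "y \<notin> edom S \<phi>"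
  then have inf: "\<phi> y = \<infinity>" using assms(2) by (auto simp: edom_def)
  obtain w where "w \<in> S" "\<phi> w < \<infinity>" using assms(3) by (auto simp: edom_def)
  then show False using assms(1) inf by (auto simp: subdifferential_def)
qed

lemma subdifferential_monotone:
  assumes s: "s \<in> subdifferential S \<phi> y" and t: "t \<in> subdifferential S \<phi> w"
    and yw: "y \<in> S" "w \<in> S" and ne: "edom S \<phi> \<noteq> {}" and gt: "\<And>y. y \<in> S \<Longrightarrow> \<phi> y > - \<infinity>"
  shows "0 \<le> (s - t) \<bullet> (y - w)"
proof -
  have "\<phi> y < \<infinity>" "\<phi> w < \<infinity>"
    using subdifferential_edom[OF s yw(1) ne] subdifferential_edom[OF t yw(2) ne]
    by (auto simp: edom_def)
  then obtain a b where a: "\<phi> y = ereal a" and b: "\<phi> w = ereal b"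
    using gt[OF yw(1)] gt[OF yw(2)] by (metis ereal_cases less_irrefl)
  have "\<phi> y + ereal (s \<bullet> (w - y)) \<le> \<phi> w" "\<phi> w + ereal (t \<bullet> (y - w)) \<le> \<phi> y"
    using s t yw by (auto simp: subdifferential_def)
  then have "a + s \<bullet> (w - y) \<le> b" "b + t \<bullet> (y - w) \<le> a" by (simp_all add: a b)
  then show ?thesis by (simp add: inner_diff algebra_simps)
qed

text \<open>\<open>lsc_fun\<close> refers to punctured neighbourhoods; a sequence may hit its limit, and there the bound
\<open>e < \<phi> y\<close> itself takes over.\<close>

lemma lsc_fun_le_limit:
  fixes \<phi> :: "'a::topological_space \<Rightarrow> ereal"
  assumes lsc: "lsc_fun S \<phi>" and y: "y \<in> S" and ys: "\<And>k. ys k \<in> S" and lim: "ys \<longlonglongrightarrow> y"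
    and le: "\<And>k. \<phi> (ys k) \<le> c k" and c: "c \<longlonglongrightarrow> c'"
  shows "\<phi> y \<le> c'"
proof (rule ccontr)
  assume "\<not> \<phi> y \<le> c'"
  then obtain e where e: "c' < e" "e < \<phi> y" using dense by (meson not_le)
  have "e < Liminf (at y within S) \<phi>" using e(2) lsc y by (auto simp: lsc_fun_def)
  then have "\<forall>\<^sub>F x in at y within S. e < \<phi> x" by (rule less_LiminfD)
  then have "\<forall>\<^sub>F x in nhds y. x \<in> S \<longrightarrow> e < \<phi> x"
    using e(2) by (auto simp: eventually_at_filter elim!: eventually_mono)
  then have "\<forall>\<^sub>F k in sequentially. e < \<phi> (ys k)"
    using lim ys by (auto simp: filterlim_iff)
  moreover have "\<forall>\<^sub>F k in sequentially. c k < e" using c e(1) by (rule order_tendstoD)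
  ultimately have "\<forall>\<^sub>F k in sequentially. False"
    by eventually_elim (use le in \<open>meson less_le_trans less_trans less_irrefl\<close>)
  then show False by simp
qed

text \<open>A subgradient inequality passes to the limit from below by lower semicontinuity. It is enough to test it at
points \<open>w\<close> of finite value, where \<open>\<phi> (ys k) \<le> \<phi> w - ss k \<bullet> (w - ys k)\<close> has a convergent right-hand side.\<close>

lemma subdifferential_closed:
  assumes S: "closed S" and lsc: "lsc_fun S \<phi>" and gt: "\<And>y. y \<in> S \<Longrightarrow> \<phi> y > - \<infinity>"
    and ys: "\<And>k. ys k \<in> S" "ys \<longlonglongrightarrow> y" and ss: "\<And>k. ss k \<in> subdifferential S \<phi> (ys k)" "ss \<longlonglongrightarrow> s"
  shows "s \<in> subdifferential S \<phi> y"
proof -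
  have "s \<in> S" by (rule closed_sequentially[OF S _ ss(2)]) (use ss(1) in \<open>auto simp: subdifferential_def\<close>)
  moreover have yS: "y \<in> S" by (rule closed_sequentially[OF S _ ys(2)]) (rule ys(1))
  moreover have "\<phi> y + ereal (s \<bullet> (w - y)) \<le> \<phi> w" if w: "w \<in> S" for w
  proof (cases "\<phi> w")
    case (real b)
    have lim: "(\<lambda>k. ereal (b - ss k \<bullet> (w - ys k))) \<longlonglongrightarrow> ereal (b - s \<bullet> (w - y))"
      by (intro tendsto_intros ys ss)
    have "\<phi> (ys k) \<le> ereal (b - ss k \<bullet> (w - ys k))" for k
    proof -
      have "\<phi> (ys k) + ereal (ss k \<bullet> (w - ys k)) \<le> ereal b"
        using ss(1)[of k] w real by (auto simp: subdifferential_def)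
      then show ?thesis by (cases "\<phi> (ys k)") auto
    qed
    then have "\<phi> y \<le> ereal (b - s \<bullet> (w - y))" by (rule lsc_fun_le_limit[OF lsc yS ys _ lim])
    then show ?thesis using real by (cases "\<phi> y") auto
  qed (use gt[OF w] in auto)
  ultimately show ?thesis by (simp add: subdifferential_def)
qed

lemma normal_cone_iff: "v \<in> normal_cone K x \<longleftrightarrow> x \<in> K \<and> (\<forall>y\<in>K. v \<bullet> (y - x) \<le> 0)"
  by (simp add: normal_cone_def)

lemma normal_cone_monotone:
  assumes "v \<in> normal_cone K x" "w \<in> normal_cone K y"
  shows "0 \<le> (v - w) \<bullet> (x - y)"
proof -
  have "v \<bullet> (y - x) \<le> 0" "w \<bullet> (x - y) \<le> 0" using assms by (auto simp: normal_cone_iff)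
  then show ?thesis by (simp add: inner_diff algebra_simps)
qed

lemma normal_cone_closed:
  assumes K: "closed K" and v: "\<And>k. vs k \<in> normal_cone K (xs k)" "vs \<longlonglongrightarrow> v" and x: "xs \<longlonglongrightarrow> x"
  shows "v \<in> normal_cone K x"
proof -
  have "x \<in> K" by (rule closed_sequentially[OF K _ x]) (use v(1) in \<open>simp add: normal_cone_iff\<close>)
  moreover have "v \<bullet> (y - x) \<le> 0" if "y \<in> K" for y
  proof (rule LIMSEQ_le_const2)
    show "(\<lambda>k. vs k \<bullet> (y - xs k)) \<longlonglongrightarrow> v \<bullet> (y - x)" by (intro tendsto_intros v x)
  qed (use v(1) that in \<open>auto simp: normal_cone_iff\<close>)
  ultimately show ?thesis by (simp add: normal_cone_iff)
qed

lemma closed_nonneg_orthant: "closed {l :: real^'m. 0 \<le> l}"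
  using closed_eucl_atLeast[of "0 :: real^'m"] by (simp add: atLeast_def)

text \<open>Testing the normal cone at \<open>l\<close> plus a unit vector gives the sign, testing it at \<open>0\<close> and at \<open>2 l\<close>
gives complementary slackness.\<close>

lemma normal_cone_orthant_complementarity:
  fixes l s :: "real^'m"
  assumes "s \<in> normal_cone {l. 0 \<le> l} l"
  shows "0 \<le> l" and "s \<le> 0" and "s \<bullet> l = 0"
proof -
  show l: "0 \<le> l" using assms by (simp add: normal_cone_iff)
  have le: "s \<bullet> (y - l) \<le> 0" if "0 \<le> y" for y using assms that by (simp add: normal_cone_iff)
  have "s $ r \<le> 0" for r
  proof -
    have "0 \<le> l + axis r 1" using l by (simp add: less_eq_vec_def axis_def)
    then show ?thesis using le[of "l + axis r 1"] by (simp add: inner_axis)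
  qed
  then show "s \<le> 0" by (simp add: less_eq_vec_def)
  show "s \<bullet> l = 0"
    using le[of 0] le[of "2 *\<^sub>R l"] l by (simp add: less_eq_vec_def inner_diff scaleR_2 inner_add)
qed

section \<open>Own coordinates and partial gradients\<close>

lemma blk_component: "blk own i x $ c = (if own c = i then x $ c else 0)"
  by (simp add: blk_def)

lemma blk_in_strat: "blk own i x \<in> strat own i"
  by (simp add: strat_def blk_def)

lemma bounded_linear_blk: "bounded_linear (blk own i :: real^'d \<Rightarrow> real^'d)"
  unfolding linear_conv_bounded_linear[symmetric]
  by (rule linearI) (simp_all add: vec_eq_iff blk_component)

lemma closed_strat: "closed (strat own i :: (real^'d) set)"
  unfolding strat_def by (intro closed_Collect_all closed_Collect_imp closed_Collect_eq continuous_intros) auto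

lemma sum_blk_inner_blk: "(\<Sum>i\<in>UNIV. blk own i x \<bullet> blk own i y) = x \<bullet> y"
  for own :: "'d::finite \<Rightarrow> 'i::finite"
proof -
  have "(\<Sum>i\<in>UNIV. blk own i x \<bullet> blk own i y) = (\<Sum>i\<in>UNIV. \<Sum>c\<in>UNIV. if own c = i then x $ c * y $ c else 0)"
    by (simp add: inner_vec_def blk_component if_distrib cong: if_cong)
  also have "\<dots> = x \<bullet> y"
    by (subst sum.swap) (simp add: inner_vec_def)
  finally show ?thesis .
qed

lemma join_blk: "join own i (blk own i y) x = join own i y x"
  by (simp add: join_def blk_def vec_eq_iff)

lemma join_self: "join own i x x = x"
  by (simp add: join_def vec_eq_iff)

lemma GDERIV_unique: "GDERIV f x :> D \<Longrightarrow> GDERIV f x :> E \<Longrightarrow> D = E"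
  unfolding gderiv_def using has_derivative_unique[of f "\<lambda>h. h \<bullet> D" x "\<lambda>h. h \<bullet> E"]
  by (metis vector_eq_ldot)

lemma pgrad_GDERIV:
  assumes "C1_own own f i x"
  shows "GDERIV (\<lambda>y. f i (join own i y x)) x :> pgrad own f i x"
proof -
  obtain G where G: "\<And>y. GDERIV (\<lambda>y. f i (join own i y x)) y :> G y"
    using assms by (auto simp: C1_own_def)
  show ?thesis unfolding pgrad_def
    by (rule theI[where P = "\<lambda>D. GDERIV (\<lambda>y. f i (join own i y x)) x :> D", OF G[of x]])
      (rule GDERIV_unique[OF _ G[of x]])
qed

text \<open>\<open>y \<mapsto> f i (join own i y x)\<close> is unchanged by moving the coordinates of the other agents, so its derivative
factors through \<open>blk own i\<close>.\<close>

lemma blk_pgrad: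
  assumes "C1_own own f i x"
  shows "blk own i (pgrad own f i x) = pgrad own f i x"
proof -
  let ?\<phi> = "\<lambda>y. f i (join own i y x)" and ?D = "pgrad own f i x"
  have D: "(?\<phi> has_derivative (\<lambda>h. h \<bullet> ?D)) (at x)"
    using pgrad_GDERIV[OF assms] by (simp add: gderiv_def)
  have "((\<lambda>y. blk own i y + (x - blk own i x)) has_derivative blk own i) (at x)"
    using bounded_linear.has_derivative[OF bounded_linear_blk has_derivative_ident]
    by (auto intro!: derivative_eq_intros)
  moreover have "(?\<phi> has_derivative (\<lambda>h. h \<bullet> ?D)) (at (blk own i x + (x - blk own i x)))"
    using D by simp
  ultimately have "(?\<phi> \<circ> (\<lambda>y. blk own i y + (x - blk own i x)) has_derivative (\<lambda>h. h \<bullet> ?D) \<circ> blk own i) (at x)"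
    by (rule diff_chain_at)
  then have D': "(?\<phi> \<circ> (\<lambda>y. blk own i y + (x - blk own i x)) has_derivative (\<lambda>h. blk own i h \<bullet> ?D)) (at x)"
    by (simp add: o_def)
  have "?\<phi> \<circ> (\<lambda>y. blk own i y + (x - blk own i x)) = ?\<phi>"
    by (rule ext, simp, rule arg_cong[of _ _ "f i"]) (simp add: join_def blk_def vec_eq_iff)
  then have "(?\<phi> has_derivative (\<lambda>h. blk own i h \<bullet> ?D)) (at x)" using D' by (simp only:)
  then have "(\<lambda>h. blk own i h \<bullet> ?D) = (\<lambda>h. h \<bullet> ?D)" using D by (rule has_derivative_unique)
  then have eq: "blk own i h \<bullet> ?D = h \<bullet> ?D" for h by (rule fun_cong)
  have "?D $ c = 0" if "own c \<noteq> i" for c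
  proof -
    have "blk own i (axis c 1) = 0" using that by (auto simp: vec_eq_iff blk_component axis_def)
    then show ?thesis using eq[of "axis c 1"] by (simp add: inner_axis')
  qed
  then show ?thesis by (auto simp: vec_eq_iff blk_component)
qed

lemma blk_pseudograd:
  assumes "\<And>i. C1_own own f i x"
  shows "blk own i (pseudograd own f x) = pgrad own f i x"
proof -
  have "blk own i (pseudograd own f x) = blk own i (pgrad own f i x)"
    by (auto simp: vec_eq_iff blk_component pseudograd_def)
  then show ?thesis by (simp add: blk_pgrad assms)
qed

text \<open>The gradient inequality of convex functions, along the line through \<open>blk own i x\<close> and \<open>y\<close>. This line stays in the
subspace \<open>strat own i\<close>, on which convexity is available, while the derivative is the one at the full vector \<open>x\<close>;
both descriptions give the same function of the line parameter.\<close>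

lemma pgrad_supports:
  assumes C1: "C1_own own f i x" and conv: "convex_on (strat own i) (\<lambda>y. f i (join own i y x))"
    and y: "y \<in> strat own i"
  shows "f i x + pgrad own f i x \<bullet> (y - blk own i x) \<le> f i (join own i y x)"
proof -
  let ?\<phi> = "\<lambda>y. f i (join own i y x)" and ?D = "pgrad own f i x"
  define h where "h = y - blk own i x"
  have h: "h \<in> strat own i" using y by (simp add: h_def strat_def blk_component)
  have D: "(?\<phi> has_derivative (\<lambda>h. h \<bullet> ?D)) (at x)"
    using pgrad_GDERIV[OF C1] by (simp add: gderiv_def)
  define \<psi> where "\<psi> t = ?\<phi> (x + t *\<^sub>R h)" for t
  have \<psi>: "\<psi> t = ?\<phi> (blk own i x + t *\<^sub>R h)" for t
    unfolding \<psi>_def by (rule arg_cong[of _ _ "f i"]) (simp add: join_def blk_def vec_eq_iff)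
  have mem: "blk own i x + t *\<^sub>R h \<in> strat own i" for t
    using h by (simp add: strat_def blk_component)
  have "convex_on UNIV \<psi>"
  proof (rule convex_onI)
    fix t a b :: real assume t: "0 < t" "t < 1"
    have "blk own i x + ((1 - t) *\<^sub>R a + t *\<^sub>R b) *\<^sub>R h
        = (1 - t) *\<^sub>R (blk own i x + a *\<^sub>R h) + t *\<^sub>R (blk own i x + b *\<^sub>R h)"
      by (simp add: algebra_simps)
    then show "\<psi> ((1 - t) *\<^sub>R a + t *\<^sub>R b) \<le> (1 - t) * \<psi> a + t * \<psi> b"
      using convex_onD[OF conv, of t, OF _ _ mem[of a] mem[of b]] t by (simp only: \<psi>)
  qed simp
  moreover have "(\<psi> has_real_derivative h \<bullet> ?D) (at 0)"
  proof -
    have "((\<lambda>t. x + t *\<^sub>R h) has_derivative (\<lambda>t. t *\<^sub>R h)) (at 0)"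
      by (auto intro!: derivative_eq_intros)
    moreover have "(?\<phi> has_derivative (\<lambda>h. h \<bullet> ?D)) (at (x + 0 *\<^sub>R h))" using D by simp
    ultimately have "(?\<phi> \<circ> (\<lambda>t. x + t *\<^sub>R h) has_derivative (\<lambda>h. h \<bullet> ?D) \<circ> (\<lambda>t. t *\<^sub>R h)) (at 0)"
      by (rule diff_chain_at)
    then show ?thesis by (simp add: has_field_derivative_def \<psi>_def[abs_def] o_def mult.commute[of _ "h \<bullet> ?D"])
  qed
  ultimately have "h \<bullet> ?D * (1 - 0) \<le> \<psi> 1 - \<psi> 0"
    by (intro convex_on_imp_above_tangent[of UNIV]) auto
  moreover have "\<psi> 1 = ?\<phi> y" by (simp only: \<psi>) (simp add: h_def)
  moreover have "\<psi> 0 = f i x" by (simp add: \<psi>_def join_self)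
  ultimately show ?thesis by (simp add: h_def inner_commute)
qed

section \<open>The Laplacian\<close>

lemma matrix_vector_component: "(M *v x) $ i = (\<Sum>j\<in>UNIV. M $ i $ j * x $ j)"
  by (simp add: matrix_vector_mult_def)

lemma symmetric_component: "transpose M = M \<Longrightarrow> M $ i $ j = M $ j $ i"
  by (metis transpose_def vec_lambda_beta)

lemma laplacian_component:
  "(laplacian W *v x) $ i = (\<Sum>j\<in>UNIV. W $ i $ j * (x $ i - x $ j))" for W :: "real^'i^'i"
proof -
  have "(laplacian W *v x) $ i
      = (\<Sum>j\<in>UNIV. (if i = j then (\<Sum>k\<in>UNIV. W $ i $ k) * x $ j else 0) - W $ i $ j * x $ j)"
    unfolding matrix_vector_component
    by (rule sum.cong) (auto simp: laplacian_def matrix_vector_component algebra_simps)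
  also have "\<dots> = (\<Sum>k\<in>UNIV. W $ i $ k) * x $ i - (\<Sum>j\<in>UNIV. W $ i $ j * x $ j)"
    by (simp add: sum_subtractf)
  also have "\<dots> = (\<Sum>j\<in>UNIV. W $ i $ j * (x $ i - x $ j))"
    by (simp add: sum_distrib_right sum_subtractf right_diff_distrib)
  finally show ?thesis .
qed

lemma transpose_laplacian:
  assumes "transpose W = W"
  shows "transpose (laplacian W) = laplacian W"
  using symmetric_component[OF assms] by (auto simp: vec_eq_iff transpose_def laplacian_def)

text \<open>The Dirichlet energy of the graph: each edge is counted from both ends, whence the factor \<open>2\<close>.\<close>

lemma laplacian_quadratic_form:
  fixes W :: "real^'i^'i"
  assumes "transpose W = W"
  shows "2 * (x \<bullet> (laplacian W *v x)) = (\<Sum>i\<in>UNIV. \<Sum>j\<in>UNIV. W $ i $ j * (x $ i - x $ j)\<^sup>2)"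
proof -
  have 1: "x \<bullet> (laplacian W *v x) = (\<Sum>i\<in>UNIV. \<Sum>j\<in>UNIV. W $ i $ j * (x $ i * (x $ i - x $ j)))"
    by (simp add: inner_vec_def laplacian_component sum_distrib_left mult_ac)
  also have "\<dots> = (\<Sum>i\<in>UNIV. \<Sum>j\<in>UNIV. W $ i $ j * (x $ j * (x $ j - x $ i)))"
    by (subst sum.swap) (intro sum.cong refl arg_cong2[of _ _ _ _ "(*)"] symmetric_component assms)
  finally have 2: "x \<bullet> (laplacian W *v x) = \<dots>" .
  have "2 * (x \<bullet> (laplacian W *v x)) = x \<bullet> (laplacian W *v x) + x \<bullet> (laplacian W *v x)" by simp
  also have "\<dots> = (\<Sum>i\<in>UNIV. \<Sum>j\<in>UNIV. W $ i $ j * (x $ i * (x $ i - x $ j)))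
      + (\<Sum>i\<in>UNIV. \<Sum>j\<in>UNIV. W $ i $ j * (x $ j * (x $ j - x $ i)))"
    by (rule arg_cong2[OF 1 2])
  also have "\<dots> = (\<Sum>i\<in>UNIV. \<Sum>j\<in>UNIV. W $ i $ j * (x $ i - x $ j)\<^sup>2)"
    by (simp add: sum.distrib[symmetric] power2_eq_square algebra_simps)
  finally show ?thesis .
qed

lemma laplacian_nonneg:
  assumes "transpose W = W" "\<And>i j. 0 \<le> W $ i $ j"
  shows "0 \<le> x \<bullet> (laplacian W *v x)"
proof -
  have "0 \<le> 2 * (x \<bullet> (laplacian W *v x))"
    unfolding laplacian_quadratic_form[OF assms(1)] by (intro sum_nonneg mult_nonneg_nonneg assms) simp
  then show ?thesis by simp
qed

text \<open>Zero energy forces equal values across every edge. A level set of \<open>x\<close> then has no edge leaving it, and by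
irreducibility it is everything.\<close>

lemma laplacian_kernel:
  fixes W :: "real^'i^'i"
  assumes sym: "transpose W = W" and nonneg: "\<And>i j. 0 \<le> W $ i $ j" and irr: "irreducible_mat W"
    and zero: "x \<bullet> (laplacian W *v x) = 0"
  shows "x $ i = x $ j"
proof -
  have "(\<Sum>i\<in>UNIV. \<Sum>j\<in>UNIV. W $ i $ j * (x $ i - x $ j)\<^sup>2) = 0"
    using laplacian_quadratic_form[OF sym, of x] zero by simp
  then have "W $ i $ j * (x $ i - x $ j)\<^sup>2 = 0" for i j
    by (simp add: sum_nonneg_eq_0_iff sum_nonneg nonneg)
  then have "W $ k $ l = 0 \<or> x $ k = x $ l" for k l by simp
  then have edge: "W $ k $ l = 0" if "x $ k \<noteq> x $ l" for k l using that by blast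
  let ?S = "{k. x $ k = x $ j}"
  have "?S = UNIV"
  proof (rule ccontr)
    assume proper: "?S \<noteq> UNIV"
    have "?S \<noteq> {}" by auto
    moreover have "\<forall>k\<in>?S. \<forall>l\<in>- ?S. W $ k $ l = 0" by (intro ballI edge) simp
    ultimately have "\<exists>S. S \<noteq> {} \<and> S \<noteq> UNIV \<and> (\<forall>k\<in>S. \<forall>l\<in>- S. W $ k $ l = 0)"
      using proper by (intro exI[of _ ?S] conjI)
    then show False using irr[unfolded irreducible_mat_def] by (rule notE[rotated])
  qed
  then show ?thesis by (simp add: set_eq_iff)
qed

lemma sum_laplacian_eq_0:
  fixes W :: "real^'i^'i"
  assumes "transpose W = W"
  shows "(\<Sum>i\<in>UNIV. (laplacian W *v x) $ i) = 0"
proof -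
  have "(\<Sum>i\<in>UNIV. (laplacian W *v x) $ i) = 1 \<bullet> (laplacian W *v x)"
    by (simp add: inner_vec_def)
  also have "\<dots> = (laplacian W *v 1) \<bullet> x"
    using dot_lmul_matrix[of 1 "laplacian W" x] transpose_laplacian[OF assms]
    by (metis transpose_matrix_vector)
  also have "laplacian W *v 1 = 0" by (simp add: vec_eq_iff laplacian_component)
  finally show ?thesis by simp
qed

text \<open>\<open>L + 1 1\<^sup>T\<close> is injective, since its quadratic form vanishes only on constant vectors of sum zero; hence it is
surjective. A preimage of a vector of sum zero under it has sum zero itself, because \<open>L\<close> only produces vectors of
sum zero, so on it the added rank-one term vanishes.\<close>

lemma laplacian_range:
  fixes W :: "real^'i^'i"
  assumes sym: "transpose W = W" and nonneg: "\<And>i j. 0 \<le> W $ i $ j" and irr: "irreducible_mat W"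
    and y: "(\<Sum>i\<in>UNIV. y $ i) = 0"
  shows "\<exists>z. laplacian W *v z = y"
proof -
  define T where "T x = laplacian W *v x + (\<Sum>i\<in>UNIV. x $ i) *\<^sub>R (1 :: real^'i)" for x
  have "linear T"
    by (rule linearI)
      (simp_all add: T_def matrix_vector_right_distrib matrix_vector_mult_scaleR sum.distrib
        scaleR_add_left sum_distrib_left[symmetric] scaleR_add_right)
  moreover have "x = 0" if "T x = 0" for x
  proof -
    have "x \<bullet> T x = x \<bullet> (laplacian W *v x) + (\<Sum>i\<in>UNIV. x $ i)\<^sup>2"
      by (simp add: T_def inner_add_right inner_vec_def[of x 1] power2_eq_square)
    then have "x \<bullet> (laplacian W *v x) = 0" and s: "(\<Sum>i\<in>UNIV. x $ i) = 0"
      using that laplacian_nonneg[OF sym nonneg, of x]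
      by (simp_all add: add_nonneg_eq_0_iff)
    then have c: "x $ i = x $ j" for i j by (intro laplacian_kernel[OF sym nonneg irr])
    have "(\<Sum>j\<in>UNIV. x $ j) = CARD('i) * x $ i" for i
      by (subst sum.cong[OF refl c[of _ i]]) simp
    then show "x = 0" using s by (simp add: vec_eq_iff)
  qed
  ultimately have "surj T"
    by (intro linear_injective_imp_surjective) (simp_all add: linear_injective_0)
  then obtain z where z: "T z = y" by (metis surjD)
  have "(\<Sum>i\<in>UNIV. T z $ i) = CARD('i) * (\<Sum>i\<in>UNIV. z $ i)"
    by (simp add: T_def sum.distrib sum_laplacian_eq_0[OF sym])
  then have "(\<Sum>i\<in>UNIV. z $ i) = 0" using z y by simp
  then show ?thesis using z by (auto simp: T_def)
qed

section \<open>Stacked vectors and matrices\<close>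

text \<open>The \<open>r\<close>-th components of all blocks: \<open>Lbar W\<close> acts on each such slice separately, as the Laplacian.\<close>

definition slice :: "real^('i::finite \<times> 'm::finite) \<Rightarrow> 'm \<Rightarrow> real^'i" where
  "slice y r = (\<chi> i. y $ (i, r))"

definition consensus :: "real^'m \<Rightarrow> real^('i::finite \<times> 'm::finite)" where
  "consensus l = (\<chi> p. l $ snd p)"

definition block_sum :: "real^('i::finite \<times> 'm::finite) \<Rightarrow> real^'m" where
  "block_sum y = (\<chi> r. \<Sum>i\<in>UNIV. y $ (i, r))"

lemma sum_pairs: "(\<Sum>p\<in>UNIV. h p) = (\<Sum>r\<in>UNIV. \<Sum>i\<in>UNIV. h (i, r))"
  for h :: "'i::finite \<times> 'm::finite \<Rightarrow> real"
  by (subst sum.swap) (simp add: sum.cartesian_product)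

lemma Lbar_component: "(Lbar W *v y) $ (i, r) = (laplacian W *v slice y r) $ i"
proof -
  have "(Lbar W *v y) $ (i, r)
      = (\<Sum>s\<in>UNIV. \<Sum>j\<in>UNIV. if r = s then laplacian W $ i $ j * y $ (j, s) else 0)"
    unfolding matrix_vector_component sum_pairs
    by (intro sum.cong) (auto simp: Lbar_def kron_def mat_def)
  also have "\<dots> = (\<Sum>j\<in>UNIV. laplacian W $ i $ j * y $ (j, r))"
    by (subst sum.swap) simp
  finally show ?thesis by (simp add: matrix_vector_component slice_def)
qed

lemma inner_slices: "x \<bullet> y = (\<Sum>r\<in>UNIV. slice x r \<bullet> slice y r)" for x y :: "real^('i::finite \<times> 'm::finite)"
  by (simp add: inner_vec_def sum_pairs slice_def)

lemma slice_Lbar: "slice (Lbar W *v y) r = laplacian W *v slice y r"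
  by (simp add: vec_eq_iff slice_def[of "Lbar W *v y"] Lbar_component)

lemma norm_matrix_le_spec_norm: "norm (M *v x) \<le> spec_norm M * norm x" for M :: "real^'a^'b"
  unfolding spec_norm_def by (rule onorm[OF matrix_vector_mul_bounded_linear])

lemma spec_norm_nonneg: "0 \<le> spec_norm M" for M :: "real^'a^'b"
  unfolding spec_norm_def by (rule onorm_pos_le[OF matrix_vector_mul_bounded_linear])

lemma inner_transpose: "(transpose M *v x) \<bullet> y = x \<bullet> (M *v y)" for M :: "real^'a^'b"
  by (simp add: transpose_matrix_vector dot_lmul_matrix)

lemma norm_transpose_le_spec_norm: "norm (transpose M *v x) \<le> spec_norm M * norm x"
  for M :: "real^'a^'b"
proof (cases "transpose M *v x = 0")
  case False
  let ?y = "transpose M *v x"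
  have "norm ?y * norm ?y = x \<bullet> (M *v ?y)"
    using inner_transpose[of M x ?y] by (simp add: power2_norm_eq_inner power2_eq_square[symmetric])
  also have "\<dots> \<le> norm x * norm (M *v ?y)" by (rule norm_cauchy_schwarz)
  also have "\<dots> \<le> norm x * (spec_norm M * norm ?y)"
    by (intro mult_left_mono norm_matrix_le_spec_norm) simp
  finally have "norm ?y * norm ?y \<le> (spec_norm M * norm x) * norm ?y" by (simp add: mult_ac)
  then show ?thesis using False by simp
qed (simp add: spec_norm_nonneg)

text \<open>The identity factor of the Kronecker product does not increase the spectral norm: the squared norm is the sum over slices.\<close>

lemma norm_Lbar_le: "norm (Lbar W *v y) \<le> spec_norm (laplacian W) * norm y"
  for y :: "real^('i::finite \<times> 'm::finite)"
proof (rule power2_le_imp_le)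
  have "(norm (Lbar W *v y))\<^sup>2 = (\<Sum>r\<in>UNIV. (norm (laplacian W *v slice y r))\<^sup>2)"
    by (simp add: power2_norm_eq_inner inner_slices[of "Lbar W *v y"] slice_Lbar)
  also have "\<dots> \<le> (\<Sum>r\<in>UNIV. (spec_norm (laplacian W) * norm (slice y r))\<^sup>2)"
    by (intro sum_mono power_mono norm_matrix_le_spec_norm) simp
  also have "\<dots> = (spec_norm (laplacian W) * norm y)\<^sup>2"
    by (simp add: power_mult_distrib power2_norm_eq_inner inner_slices[of y] sum_distrib_left)
  finally show "(norm (Lbar W *v y))\<^sup>2 \<le> (spec_norm (laplacian W) * norm y)\<^sup>2" .
qed (simp add: spec_norm_nonneg)

lemma inner_Lbar_commute:
  fixes x y :: "real^('i::finite \<times> 'm::finite)"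
  assumes "transpose W = W"
  shows "(Lbar W *v x) \<bullet> y = x \<bullet> (Lbar W *v y)"
  unfolding inner_slices slice_Lbar
  using inner_transpose[of "laplacian W"] by (simp add: transpose_laplacian[OF assms])

lemma Lbar_nonneg:
  fixes y :: "real^('i::finite \<times> 'm::finite)"
  assumes "transpose W = W" "\<And>i j. 0 \<le> W $ i $ j"
  shows "0 \<le> y \<bullet> (Lbar W *v y)"
  unfolding inner_slices slice_Lbar by (intro sum_nonneg laplacian_nonneg assms)

lemma Lbar_consensus: "Lbar W *v consensus l = (0 :: real^('i::finite \<times> 'm::finite))"
proof -
  have "(Lbar W *v consensus l) $ (i, r) = (0::real)" for i :: 'i and r :: 'm
    by (simp add: Lbar_component laplacian_component slice_def consensus_def)
  then show ?thesis by (auto simp: vec_eq_iff)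
qed

lemma Lbar_kernel:
  fixes y :: "real^('i::finite \<times> 'm::finite)"
  assumes W: "transpose W = W" "\<And>i j. 0 \<le> W $ i $ j" "irreducible_mat W" and zero: "Lbar W *v y = 0"
  shows "\<exists>l. y = consensus l"
proof -
  obtain i0 :: 'i where True by blast
  have "slice y r $ i = slice y r $ i0" for i r
    by (rule laplacian_kernel[OF W]) (simp add: slice_Lbar[symmetric] zero, simp add: slice_def inner_vec_def)
  then have "y = consensus (\<chi> r. y $ (i0, r))" by (simp add: vec_eq_iff consensus_def slice_def)
  then show ?thesis ..
qed

lemma block_sum_Lbar:
  assumes "transpose W = W"
  shows "block_sum (Lbar W *v y) = 0"
  by (simp add: vec_eq_iff block_sum_def Lbar_component sum_laplacian_eq_0[OF assms])

lemma Lbar_range: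
  fixes y :: "real^('i::finite \<times> 'm::finite)"
  assumes W: "transpose W = W" "\<And>i j. 0 \<le> W $ i $ j" "irreducible_mat W" and y: "block_sum y = 0"
  shows "\<exists>z. Lbar W *v z = y"
proof -
  have "\<exists>z. laplacian W *v z = slice y r" for r
    using y by (intro laplacian_range[OF W]) (simp add: block_sum_def slice_def vec_eq_iff)
  then obtain Z where Z: "\<And>r. laplacian W *v Z r = slice y r" by metis
  define z :: "real^('i \<times> 'm)" where "z = (\<chi> p. Z (snd p) $ fst p)"
  have "slice z r = Z r" for r by (simp add: slice_def z_def vec_eq_iff)
  then have "(Lbar W *v z) $ (i, r) = y $ (i, r)" for i r
    by (simp add: Lbar_component Z) (simp add: slice_def)
  then have "Lbar W *v z = y" by (auto simp: vec_eq_iff)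
  then show ?thesis ..
qed

lemma inner_consensus: "y \<bullet> consensus l = block_sum y \<bullet> l"
  by (simp add: inner_vec_def sum_pairs consensus_def block_sum_def sum_distrib_right)

lemma block_sum_bcol: "block_sum (bcol bs) = bsum bs"
  by (simp add: vec_eq_iff block_sum_def bcol_def bsum_def)

lemma Ablk_mult: "(Ablk own A i *v x) $ r = (\<Sum>c\<in>UNIV. if own c = i then A $ r $ c * x $ c else 0)"
  by (auto simp: matrix_vector_component Ablk_def intro!: sum.cong)

lemma Adiag_component: "(Adiag own A *v x) $ (i, r) = (Ablk own A i *v x) $ r"
  unfolding Ablk_mult by (auto simp: matrix_vector_component Adiag_def intro!: sum.cong)

lemma Ablk_blk: "Ablk own A i *v blk own i x = Ablk own A i *v x"
  by (auto simp: vec_eq_iff Ablk_mult blk_component intro!: sum.cong)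

lemma sum_Ablk: "(\<Sum>i\<in>UNIV. Ablk own A i *v x) = A *v x" for own :: "'d::finite \<Rightarrow> 'i::finite"
proof -
  have "(\<Sum>i\<in>UNIV. (Ablk own A i *v x) $ r) = (A *v x) $ r" for r
    unfolding Ablk_mult by (subst sum.swap) (simp add: matrix_vector_component)
  then show ?thesis by (simp add: vec_eq_iff)
qed

lemma block_sum_Adiag: "block_sum (Adiag own A *v x) = A *v x" for own :: "'d::finite \<Rightarrow> 'i::finite"
  by (simp add: sum_Ablk[of own A x, symmetric] vec_eq_iff block_sum_def Adiag_component)

lemma blk_transpose_Adiag_consensus:
  fixes own :: "'d::finite \<Rightarrow> 'i::finite"
  shows "blk own i (transpose (Adiag own A) *v consensus l) = transpose (Ablk own A i) *v l"
proof -
  have "(transpose (Adiag own A) *v consensus l) $ c = (\<Sum>r\<in>UNIV. A $ r $ c * l $ r)" for c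
  proof -
    have "(transpose (Adiag own A) *v consensus l) $ c
        = (\<Sum>r\<in>UNIV. \<Sum>i\<in>UNIV. if own c = i then A $ r $ c * l $ r else 0)"
      unfolding matrix_vector_component sum_pairs
      by (intro sum.cong) (auto simp: transpose_def Adiag_def consensus_def)
    then show ?thesis by simp
  qed
  then show ?thesis
    by (auto simp: vec_eq_iff blk_component matrix_vector_component transpose_def Ablk_def)
qed

section \<open>Karush-Kuhn-Tucker systems and zeros\<close>

text \<open>The two inclusions in \<open>is_vGNE\<close>, solved for the elements of the subdifferential and of the normal cone and with the
multiplier \<open>l\<close> as a parameter.\<close>

definition KKT :: "('d::finite \<Rightarrow> 'i::finite) \<Rightarrow> ('i \<Rightarrow> real^'d \<Rightarrow> real) \<Rightarrow> ('i \<Rightarrow> real^'d \<Rightarrow> ereal) \<Rightarrow>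
    real^'d^'m::finite \<Rightarrow> ('i \<Rightarrow> real^'m) \<Rightarrow> real^'d \<Rightarrow> real^'m \<Rightarrow> bool" where
  "KKT own f g A bs x l \<longleftrightarrow>
     (\<forall>i. - (pgrad own f i x + transpose (Ablk own A i) *v l)
            \<in> subdifferential (strat own i) (g i) (blk own i x)) \<and>
     A *v x - bsum bs \<in> normal_cone {l. 0 \<le> l} l"

lemma is_vGNE_iff: "is_vGNE own f g A bs x \<longleftrightarrow> is_GNE own f g A bs x \<and> (\<exists>l. KKT own f g A bs x l)"
proof -
  have zero_grad: "0 \<in> {a} + S + {b} \<longleftrightarrow> - (a + b) \<in> S" for a b :: "'x::ab_group_add" and S
    using set_plus_singleton_iff[of 0 b "{a} + S"] set_plus_singleton_iff[of "- b" a S]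
    by (simp add: add.commute[of _ "{b}"] minus_diff_commute[of b a])
  have zero_cone: "0 \<in> S + {- a} \<longleftrightarrow> a \<in> S" for a :: "'x::ab_group_add" and S
    using set_plus_singleton_iff[of 0 "- a" S] by (simp add: add.commute[of S])
  show ?thesis
    unfolding is_vGNE_def zero_grad zero_cone KKT_def by (auto simp: normal_cone_iff)
qed

text \<open>Sufficiency of the KKT system. Adding the subgradient inequality of \<open>g\<^sub>i\<close> and the gradient inequality of \<open>f\<^sub>i\<close>
bounds the change of cost below by \<open>- l \<bullet> A\<^sub>i (y - x\<^sub>i)\<close>. Up to sign this is \<open>l\<close> applied to the
difference of the two constraint residuals: for \<open>y\<close> the pairing is nonpositive by feasibility, for \<open>x\<^sub>i\<close> it vanishes by
complementarity.\<close>

lemma KKT_imp_GNE: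
  fixes own :: "'d::finite \<Rightarrow> 'i::finite" and A :: "real^'d^'m::finite"
  assumes gt: "\<And>i y. y \<in> strat own i \<Longrightarrow> g i y > - \<infinity>"
    and ne: "\<And>i. Omega_i own g i \<noteq> {}"
    and conv: "\<And>i x. convex_on (strat own i) (\<lambda>y. f i (join own i y x))"
    and C1: "\<And>i x. C1_own own f i x"
    and KKT: "KKT own f g A bs x l"
  shows "is_GNE own f g A bs x"
  unfolding is_GNE_def
proof (intro allI conjI ballI)
  fix i
  let ?xi = "blk own i x" and ?Ai = "Ablk own A i"
  define s where "s = - (pgrad own f i x + transpose ?Ai *v l)"
  have s: "s \<in> subdifferential (strat own i) (g i) ?xi" using KKT by (auto simp: KKT_def s_def)
  have "A *v x - bsum bs \<in> normal_cone {l. 0 \<le> l} l" using KKT by (simp add: KKT_def)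
  note compl = normal_cone_orthant_complementarity[OF this]
  have xi: "?xi \<in> Omega_i own g i"
    unfolding Omega_i_def using ne[of i] s
    by (intro subdifferential_edom[of s]) (auto simp: blk_in_strat Omega_i_def)
  have "A *v x = (\<Sum>j\<in>UNIV. Ablk own A j *v x)" by (rule sum_Ablk[symmetric])
  also have "\<dots> = ?Ai *v x + (\<Sum>j\<in>UNIV - {i}. Ablk own A j *v x)" by (simp add: sum.remove)
  finally have others: "(\<Sum>j\<in>UNIV - {i}. Ablk own A j *v blk own j x) = A *v x - ?Ai *v x"
    by (simp add: Ablk_blk)
  show "?xi \<in> feasible_i own g A bs i x"
    using xi compl(2) unfolding feasible_i_def others by (simp add: Ablk_blk less_eq_vec_def)

  fix y assume y: "y \<in> feasible_i own g A bs i x"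
  then have yO: "y \<in> Omega_i own g i" by (simp add: feasible_i_def)
  then have yS: "y \<in> strat own i" by (simp add: Omega_i_def edom_def)
  \<comment> \<open>the residual of the shared constraint when agent \<open>i\<close> deviates to \<open>y\<close>\<close>
  define w where "w = ?Ai *v y + (A *v x - ?Ai *v x) - bsum bs"
  have "w $ r \<le> 0" for r
    using y unfolding feasible_i_def others by (simp add: w_def less_eq_vec_def algebra_simps)
  then have "w \<bullet> l \<le> 0"
    using compl(1) by (auto simp: inner_vec_def less_eq_vec_def intro!: sum_nonpos mult_nonpos_nonneg)
  then have "(?Ai *v (y - ?xi)) \<bullet> l \<le> 0"
    using compl(3) by (simp add: w_def matrix_vector_mult_diff_distrib Ablk_blk inner_diff inner_add)
  then have "l \<bullet> (?Ai *v (y - ?xi)) \<le> 0" by (simp add: inner_commute)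
  moreover have "s \<bullet> (y - ?xi) = - (pgrad own f i x \<bullet> (y - ?xi)) + - (l \<bullet> (?Ai *v (y - ?xi)))"
    by (simp only: s_def inner_minus_left inner_add_left inner_transpose minus_add_distrib)
  moreover have "f i x + pgrad own f i x \<bullet> (y - ?xi) \<le> f i (join own i y x)"
    by (rule pgrad_supports[OF C1 conv yS])
  moreover obtain a b where a: "g i ?xi = ereal a" and b: "g i y = ereal b"
    using gt[OF blk_in_strat, of i x] gt[OF yS] xi yO
    by (cases "g i ?xi"; cases "g i y") (auto simp: Omega_i_def edom_def)
  moreover have "a + s \<bullet> (y - ?xi) \<le> b"
    using s yS by (auto simp: subdifferential_def a b)
  ultimately have "f i x + a \<le> f i (join own i y x) + b" by linarith
  then show "cost own f g i ?xi x \<le> cost own f g i y x"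
    by (simp add: cost_def join_blk join_self a b)
qed

lemma opC_iff: "(s, p, q) \<in> opC own g (x, z, l) \<longleftrightarrow>
    (\<forall>i. blk own i s \<in> subdifferential (strat own i) (g i) (blk own i x)) \<and> p = 0 \<and>
    q \<in> normal_cone {l. 0 \<le> l} l"
  by (auto simp: opC_def)

lemma opD_eq: "opD own f A bs W (x, z, l) =
    (pseudograd own f x + transpose (Adiag own A) *v l, Lbar W *v l,
     Lbar W *v l + bcol bs - Adiag own A *v x - Lbar W *v z)"
  by (simp add: opD_def opA_def opB_def)

lemma blk_minus: "blk own i (- x) = - blk own i x"
  by (simp add: vec_eq_iff blk_component)

lemma blk_add: "blk own i (x + y) = blk own i x + blk own i y"
  by (simp add: vec_eq_iff blk_component)

lemma zer_iff: "w \<in> zer (\<lambda>w. {opA own f bs W w} + {opB own A W w} + opC own g w)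
    \<longleftrightarrow> - opD own f A bs W w \<in> opC own g w"
proof -
  have "{opA own f bs W w} + {opB own A W w} = {opD own f A bs W w}"
    by (auto simp: set_plus_def opD_def)
  then show ?thesis by (simp add: zer_def set_plus_singleton_iff)
qed

lemma zero_consensus_iff:
  fixes own :: "'d::finite \<Rightarrow> 'i::finite" and A :: "real^'d^'m::finite"
  assumes C1: "\<And>i x. C1_own own f i x"
  shows "- opD own f A bs W (x, z, consensus l) \<in> opC own g (x, z, consensus l) \<longleftrightarrow>
     (\<forall>i. - (pgrad own f i x + transpose (Ablk own A i) *v l)
            \<in> subdifferential (strat own i) (g i) (blk own i x)) \<and>
     Adiag own A *v x + Lbar W *v z - bcol bs \<in> normal_cone {l. 0 \<le> l} (consensus l)"
proof -
  have "blk own i (- (pseudograd own f x + transpose (Adiag own A) *v consensus l))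
      = - (pgrad own f i x + transpose (Ablk own A i) *v l)" for i
    by (simp only: blk_minus blk_add blk_pseudograd[OF C1] blk_transpose_Adiag_consensus)
  moreover have "- (Lbar W *v consensus l + bcol bs - Adiag own A *v x - Lbar W *v z)
      = Adiag own A *v x + Lbar W *v z - bcol bs"
    by (simp add: Lbar_consensus)
  ultimately show ?thesis
    unfolding opD_eq uminus_Pair opC_iff by (simp only: Lbar_consensus neg_equal_0_iff_equal simp_thms)
qed

text \<open>The second component of a zero says \<open>Lbar W *v l = 0\<close>, so the agents agree on one multiplier. Summing the third
component over the agents removes \<open>Lbar W *v z\<close> and leaves the residual of the shared constraint; in the normal
cone this summation amounts to testing against equal blocks only.\<close>

lemma zero_imp_KKT:
  fixes own :: "'d::finite \<Rightarrow> 'i::finite" and A :: "real^'d^'m::finite"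
  assumes C1: "\<And>i x. C1_own own f i x"
    and W: "transpose W = W" "\<And>i j. 0 \<le> W $ i $ j" "irreducible_mat W"
    and zero: "- opD own f A bs W (x, z, l) \<in> opC own g (x, z, l)"
  shows "\<exists>l. KKT own f g A bs x l"
proof -
  have "Lbar W *v l = 0" using zero by (simp add: opD_eq opC_iff)
  then obtain l' where l: "l = consensus l'" using Lbar_kernel[OF W] by blast
  let ?q = "Adiag own A *v x + Lbar W *v z - bcol bs"
  have block_sum_add: "block_sum (a + b) = block_sum a + block_sum b"
    and block_sum_diff: "block_sum (a - b) = block_sum a - block_sum b" for a b :: "real^('i \<times> 'm)"
    by (simp_all add: vec_eq_iff block_sum_def sum.distrib sum_subtractf)
  have q: "?q \<in> normal_cone {l. 0 \<le> l} (consensus l')"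
    using zero zero_consensus_iff[OF C1] l by blast
  have sum_q: "block_sum ?q = A *v x - bsum bs"
    by (simp add: block_sum_add block_sum_diff block_sum_Adiag block_sum_Lbar W block_sum_bcol)
  have consensus_nonneg: "0 \<le> (consensus y :: real^('i \<times> 'm)) \<longleftrightarrow> 0 \<le> y" for y :: "real^'m"
    by (simp add: less_eq_vec_def consensus_def)
  have "?q \<bullet> (consensus y - consensus l') \<le> 0" if "0 \<le> y" for y
    using q that consensus_nonneg[of y] by (simp add: normal_cone_iff)
  then have "A *v x - bsum bs \<in> normal_cone {l. 0 \<le> l} l'"
    using q consensus_nonneg[of l']
    by (simp add: normal_cone_iff inner_diff_right inner_consensus sum_q)
  then have "KKT own f g A bs x l'"
    using zero[unfolded l zero_consensus_iff[OF C1]] by (simp add: KKT_def)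
  then show ?thesis ..
qed

text \<open>The auxiliary variable \<open>z\<close> has to redistribute the local residuals \<open>A\<^sub>i x\<^sub>i - b\<^sub>i\<close> so that every
agent holds the same share \<open>(A x - b) / N\<close>. The required correction has blocks of sum zero, hence lies in the range of
\<open>Lbar W\<close>. Equal shares are normal to the orthant at equal multipliers, as one sees by averaging the test vector.\<close>

lemma KKT_imp_zero:
  fixes own :: "'d::finite \<Rightarrow> 'i::finite" and A :: "real^'d^'m::finite"
  assumes C1: "\<And>i x. C1_own own f i x"
    and W: "transpose W = W" "\<And>i j. 0 \<le> W $ i $ j" "irreducible_mat W"
    and KKT: "KKT own f g A bs x l"
  shows "\<exists>z. - opD own f A bs W (x, z, consensus l) \<in> opC own g (x, z, consensus l)"
proof -
  define N where "N = real CARD('i)"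
  define e where "e = A *v x - bsum bs"
  define y where "y = (1 / N) *\<^sub>R consensus e - (Adiag own A *v x - bcol bs)"
  have N: "N > 0" by (simp add: N_def)
  have e: "e \<in> normal_cone {l. 0 \<le> l} l" using KKT by (simp add: KKT_def e_def)
  have block_sum_diff: "block_sum (a - b) = block_sum a - block_sum b" for a b :: "real^('i \<times> 'm)"
    by (simp add: vec_eq_iff block_sum_def sum_subtractf)
  have "block_sum ((1 / N) *\<^sub>R consensus e :: real^('i \<times> 'm)) = e"
    by (simp add: vec_eq_iff block_sum_def consensus_def N_def)
  then have "block_sum y = 0" by (simp add: y_def block_sum_diff block_sum_Adiag block_sum_bcol e_def)
  then obtain z where z: "Lbar W *v z = y" using Lbar_range[OF W] by blast
  have "Adiag own A *v x + Lbar W *v z - bcol bs = (1 / N) *\<^sub>R consensus e"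
    by (simp add: z y_def)
  moreover have "(1 / N) *\<^sub>R consensus e \<in> normal_cone {l. 0 \<le> l} (consensus l :: real^('i \<times> 'm))"
  proof -
    have "((1 / N) *\<^sub>R consensus e) \<bullet> (w - consensus l) \<le> 0" if w: "0 \<le> w" for w :: "real^('i \<times> 'm)"
    proof -
      have "0 \<le> (1 / N) *\<^sub>R block_sum w"
        using w N by (auto simp: less_eq_vec_def block_sum_def intro!: sum_nonneg divide_nonneg_pos)
      then have "e \<bullet> ((1 / N) *\<^sub>R block_sum w - l) \<le> 0" using e by (simp add: normal_cone_iff)
      moreover have "block_sum (consensus l :: real^('i \<times> 'm)) = N *\<^sub>R l"
        by (simp add: vec_eq_iff block_sum_def consensus_def N_def)
      then have "((1 / N) *\<^sub>R consensus e) \<bullet> (w - consensus l) = e \<bullet> ((1 / N) *\<^sub>R block_sum w - l)"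
        using N inner_consensus[of "w - consensus l" e]
        by (simp add: block_sum_diff inner_diff inner_commute field_simps)
      ultimately show ?thesis by simp
    qed
    moreover have "0 \<le> (consensus l :: real^('i \<times> 'm))"
      using e by (simp add: normal_cone_iff less_eq_vec_def consensus_def)
    ultimately show ?thesis by (simp add: normal_cone_iff)
  qed
  ultimately have "- opD own f A bs W (x, z, consensus l) \<in> opC own g (x, z, consensus l)"
    unfolding zero_consensus_iff[OF C1] using KKT by (simp add: KKT_def)
  then show ?thesis ..
qed

section \<open>The operators of the algorithm\<close>

text \<open>Blockwise, by monotonicity of subdifferentials and normal cones. Nonempty domains exclude the degenerate subgradients
of a function that is identically \<open>\<infinity>\<close>.\<close>

lemma monotone_opC:
  fixes own :: "'d::finite \<Rightarrow> 'i::finite" and g :: "'i \<Rightarrow> real^'d \<Rightarrow> ereal"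
  assumes gt: "\<And>i y. y \<in> strat own i \<Longrightarrow> g i y > - \<infinity>" and ne: "\<And>i. Omega_i own g i \<noteq> {}"
  shows "monotone_op (opC own g :: ('i, 'd, 'm::finite) H \<Rightarrow> _)"
  unfolding monotone_op_def
proof (intro allI ballI)
  fix w w' s s' :: "('i, 'd, 'm) H"
  assume s: "s \<in> opC own g w" and s': "s' \<in> opC own g w'"
  obtain x z l where w: "w = (x, z, l)" by (cases w)
  obtain x' z' l' where w': "w' = (x', z', l')" by (cases w')
  obtain a c where a: "s = (a, 0, c)" using s w by (cases s) (auto simp: opC_iff)
  obtain a' c' where a': "s' = (a', 0, c')" using s' w' by (cases s') (auto simp: opC_iff)
  have "0 \<le> (blk own i a - blk own i a') \<bullet> (blk own i x - blk own i x')" for i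
    by (rule subdifferential_monotone[where S = "strat own i" and \<phi> = "g i", OF _ _ _ _ _ gt])
      (use s s' ne[of i] in \<open>auto simp: w w' a a' opC_iff blk_in_strat Omega_i_def\<close>)
  moreover have "blk own i (p - q) = blk own i p - blk own i q" for i and p q :: "real^'d"
    by (simp add: vec_eq_iff blk_component)
  ultimately have "0 \<le> (a - a') \<bullet> (x - x')"
    by (subst sum_blk_inner_blk[of own, symmetric]) (intro sum_nonneg, simp)
  moreover have "0 \<le> (c - c') \<bullet> (l - l')"
    by (rule normal_cone_monotone) (use s s' in \<open>auto simp: w w' a a' opC_iff\<close>)
  ultimately show "0 \<le> (s - s') \<bullet> (w - w')" by (simp add: w w' a a')
qed

lemma closed_graph_opC:
  fixes own :: "'d::finite \<Rightarrow> 'i::finite" and g :: "'i \<Rightarrow> real^'d \<Rightarrow> ereal"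
  assumes gt: "\<And>i y. y \<in> strat own i \<Longrightarrow> g i y > - \<infinity>" and lsc: "\<And>i. lsc_fun (strat own i) (g i)"
  shows "closed {(w, s). s \<in> opC own g (w :: ('i, 'd, 'm::finite) H)}"
  unfolding closed_sequential_limits
proof (intro allI impI, elim conjE)
  fix X :: "nat \<Rightarrow> ('i, 'd, 'm) H \<times> ('i, 'd, 'm) H" and L
  assume X: "\<forall>n. X n \<in> {(w, s). s \<in> opC own g w}" and lim: "X \<longlonglongrightarrow> L"
  obtain x z l a b c where L: "L = ((x, z, l), (a, b, c))" by (metis surj_pair)
  define xs where "xs n = fst (fst (X n))" for n
  define ls where "ls n = snd (snd (fst (X n)))" for n
  define as where "as n = fst (snd (X n))" for n
  define cs where "cs n = snd (snd (snd (X n)))" for n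
  have mem: "(\<forall>i. blk own i (as n) \<in> subdifferential (strat own i) (g i) (blk own i (xs n)))
      \<and> fst (snd (snd (X n))) = 0 \<and> cs n \<in> normal_cone {l. 0 \<le> l} (ls n)" for n
    using X by (cases "X n" rule: prod.exhaust) (auto simp: xs_def ls_def as_def cs_def opC_def dest: spec[of _ n] split: prod.splits)
  have xs: "xs \<longlonglongrightarrow> x" and ls: "ls \<longlonglongrightarrow> l" and as: "as \<longlonglongrightarrow> a" and cs: "cs \<longlonglongrightarrow> c"
    and bs: "(\<lambda>n. fst (snd (snd (X n)))) \<longlonglongrightarrow> b"
    using tendsto_fst[OF tendsto_fst[OF lim]] tendsto_snd[OF tendsto_snd[OF tendsto_fst[OF lim]]]
      tendsto_fst[OF tendsto_snd[OF lim]] tendsto_snd[OF tendsto_snd[OF tendsto_snd[OF lim]]]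
      tendsto_fst[OF tendsto_snd[OF tendsto_snd[OF lim]]]
    by (simp_all add: xs_def[abs_def] ls_def[abs_def] as_def[abs_def] cs_def[abs_def] L)
  have "b = 0" using bs mem by (simp add: LIMSEQ_const_iff)
  moreover have "c \<in> normal_cone {l. 0 \<le> l} l"
  proof (rule normal_cone_closed[OF _ _ cs ls])
    show "closed {l :: real^('i \<times> 'm). 0 \<le> l}" by (rule closed_nonneg_orthant)
  qed (use mem in blast)
  moreover have "blk own i a \<in> subdifferential (strat own i) (g i) (blk own i x)" for i
    by (rule subdifferential_closed[OF closed_strat lsc gt _ _ _ bounded_linear.tendsto[OF bounded_linear_blk as]])
      (use mem in \<open>auto simp: blk_in_strat intro: bounded_linear.tendsto[OF bounded_linear_blk xs]\<close>)
  ultimately show "L \<in> {(w, s). s \<in> opC own g w}" by (simp add: L opC_iff)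
qed

text \<open>The Lipschitz constants of \<open>opA\<close> and \<open>opB\<close> add up. The estimate is stated for one pair of points, since the
bound on the pseudo-gradient is only available if one of the two points lies in \<open>Omega own g\<close>.\<close>

lemma opD_lipschitz:
  fixes own :: "'d::finite \<Rightarrow> 'i::finite" and A :: "real^'d^'m::finite"
  assumes \<beta>: "\<beta> > 0"
    and F: "norm (pseudograd own f (fst v) - pseudograd own f (fst w)) \<le> 1 / \<beta> * norm (fst v - fst w)"
  shows "norm (opD own f A bs W v - opD own f A bs W w) \<le> LipD own \<beta> A W * norm (v - w)"
proof -
  obtain x z l where v: "v = (x, z, l)" by (cases v)
  obtain x' z' l' where w: "w = (x', z', l')" by (cases w)
  define X Z M where "X = x - x'" and "Z = z - z'" and "M = l - l'"
  define \<kappa> \<alpha> n where "\<kappa> = spec_norm (laplacian W)" and "\<alpha> = spec_norm (Adiag own A)" and "n = norm (v - w)"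
  have vw: "v - w = (X, Z, M)" by (simp add: v w X_def Z_def M_def)
  have X: "norm X \<le> n" and Z: "norm Z \<le> n" and M: "norm M \<le> n"
    using norm_fst_le[of X "(Z, M)"] norm_snd_le[of "(Z, M)" X] norm_fst_le[of Z M] norm_snd_le[of M Z]
    unfolding n_def vw by linarith+
  have \<kappa>: "0 \<le> \<kappa>" and \<alpha>: "0 \<le> \<alpha>" by (simp_all add: \<kappa>_def \<alpha>_def spec_norm_nonneg)
  have triple: "norm (a, b, c) \<le> norm a + norm b + norm c"
    for a :: "real^'d" and b c :: "real^('i \<times> 'm)"
    using norm_Pair_le[of a "(b, c)"] norm_Pair_le[of b c] by linarith
  have bM: "norm (Lbar W *v M) \<le> \<kappa> * n" and bZ: "norm (Lbar W *v Z) \<le> \<kappa> * n"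
    using norm_Lbar_le[of W M] norm_Lbar_le[of W Z] mult_left_mono[OF M \<kappa>] mult_left_mono[OF Z \<kappa>]
    by (auto simp: \<kappa>_def)
  have bX: "norm (Adiag own A *v X) \<le> \<alpha> * n"
    using norm_matrix_le_spec_norm[of "Adiag own A" X] mult_left_mono[OF X \<alpha>] by (auto simp: \<alpha>_def)
  have bT: "norm (transpose (Adiag own A) *v M) \<le> \<alpha> * n"
    using norm_transpose_le_spec_norm[of "Adiag own A" M] mult_left_mono[OF M \<alpha>] by (auto simp: \<alpha>_def)
  define G where "G = pseudograd own f x - pseudograd own f x'"
  have "norm G \<le> 1 / \<beta> * norm X" using F by (simp add: v w G_def X_def)
  also have "\<dots> \<le> 1 / \<beta> * n" using X \<beta> by (intro mult_left_mono) auto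
  finally have bF: "norm G \<le> 1 / \<beta> * n" .
  have "opD own f A bs W v - opD own f A bs W w
      = (G, 0, Lbar W *v M)
        + (transpose (Adiag own A) *v M, Lbar W *v M, - (Adiag own A *v X) - Lbar W *v Z)"
    by (simp add: v w opD_eq G_def X_def Z_def M_def matrix_vector_mult_diff_distrib)
  also have "norm \<dots> \<le> norm (G, 0 :: real^('i \<times> 'm), Lbar W *v M)
      + norm (transpose (Adiag own A) *v M, Lbar W *v M, - (Adiag own A *v X) - Lbar W *v Z)"
    by (rule norm_triangle_ineq)
  also have "\<dots> \<le> (1 / \<beta> * n + \<kappa> * n) + (\<alpha> * n + \<kappa> * n + (\<alpha> * n + \<kappa> * n))"
    using triple[of G 0 "Lbar W *v M"]
      triple[of "transpose (Adiag own A) *v M" "Lbar W *v M" "- (Adiag own A *v X) - Lbar W *v Z"]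
      norm_triangle_ineq4[of "- (Adiag own A *v X)" "Lbar W *v Z"] bM bZ bX bT bF
    by (simp only: norm_zero norm_minus_cancel add_0_right)
  also have "\<dots> = LipD own \<beta> A W * n"
    by (simp add: LipD_def LipA_def LipB_def \<kappa>_def \<alpha>_def algebra_simps)
  finally show ?thesis by (simp add: n_def)
qed

lemma LipD_pos: "\<beta> > 0 \<Longrightarrow> LipD own \<beta> A W > 0"
  unfolding LipD_def LipA_def LipB_def
  by (intro add_pos_nonneg add_nonneg_nonneg mult_nonneg_nonneg spec_norm_nonneg) simp_all

text \<open>The part \<open>opB\<close> is skew, so only the pseudo-gradient and the nonnegative form of the Laplacian contribute.\<close>

lemma opD_monotone:
  fixes own :: "'d::finite \<Rightarrow> 'i::finite" and A :: "real^'d^'m::finite"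
  assumes W: "transpose W = W" "\<And>i j. 0 \<le> W $ i $ j"
    and F: "0 \<le> (pseudograd own f (fst v) - pseudograd own f (fst w)) \<bullet> (fst v - fst w)"
  shows "0 \<le> (opD own f A bs W v - opD own f A bs W w) \<bullet> (v - w)"
proof -
  obtain x z l where v: "v = (x, z, l)" by (cases v)
  obtain x' z' l' where w: "w = (x', z', l')" by (cases w)
  define X Z M where "X = x - x'" and "Z = z - z'" and "M = l - l'"
  define G where "G = pseudograd own f x - pseudograd own f x'"
  have "opD own f A bs W v - opD own f A bs W w
      = (G + transpose (Adiag own A) *v M, Lbar W *v M, Lbar W *v M - Adiag own A *v X - Lbar W *v Z)"
    by (simp add: v w opD_eq G_def X_def Z_def M_def matrix_vector_mult_diff_distrib)
  moreover have "v - w = (X, Z, M)" by (simp add: v w X_def Z_def M_def)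
  ultimately have "(opD own f A bs W v - opD own f A bs W w) \<bullet> (v - w)
      = G \<bullet> X + M \<bullet> (Adiag own A *v X) + (Lbar W *v M) \<bullet> Z
        + ((Lbar W *v M) \<bullet> M - (Adiag own A *v X) \<bullet> M - (Lbar W *v Z) \<bullet> M)"
    by (simp add: inner_add_left inner_diff_left inner_transpose del: transpose_matrix_vector)
  also have "\<dots> = G \<bullet> X + M \<bullet> (Lbar W *v M)"
    using inner_Lbar_commute[OF W(1), of M Z] by (simp add: inner_commute)
  finally show ?thesis
    using F Lbar_nonneg[OF W, of M] by (simp add: v w G_def X_def)
qed

lemma linear_Psi: "linear (Psi own \<rho> \<sigma> \<tau>)"
  by (rule linearI) (simp_all add: Psi_def case_prod_beta prod_eq_iff vec_eq_iff algebra_simps)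

lemma Psi_symmetric: "Psi own \<rho> \<sigma> \<tau> v \<bullet> w = v \<bullet> Psi own \<rho> \<sigma> \<tau> w"
  by (cases v; cases w) (simp add: Psi_def inner_vec_def mult_ac)

lemma Psi_nonneg:
  assumes "\<And>i. \<rho> i > 0" "\<And>i. \<sigma> i > 0" "\<And>i. \<tau> i > 0"
  shows "0 \<le> Psi own \<rho> \<sigma> \<tau> v \<bullet> v"
  by (cases v)
    (simp add: Psi_def inner_vec_def mult.assoc power2_eq_square[symmetric] assms less_imp_le
      add_nonneg_nonneg sum_nonneg)

lemma
  assumes "\<And>i. \<rho> i > 0" "\<And>i. \<sigma> i > 0" "\<And>i. \<tau> i > 0"
  shows bij_Psi: "bij (Psi own \<rho> \<sigma> \<tau>)"
    and inv_Psi: "inv (Psi own \<rho> \<sigma> \<tau>)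
      = Psi own (\<lambda>i. inverse (\<rho> i)) (\<lambda>i. inverse (\<sigma> i)) (\<lambda>i. inverse (\<tau> i))"
proof -
  let ?P = "Psi own (\<lambda>i. inverse (\<rho> i)) (\<lambda>i. inverse (\<sigma> i)) (\<lambda>i. inverse (\<tau> i))"
  have "\<rho> i \<noteq> 0" "\<sigma> i \<noteq> 0" "\<tau> i \<noteq> 0" for i using assms[of i] by simp_all
  then have PQ: "?P \<circ> Psi own \<rho> \<sigma> \<tau> = id" and QP: "Psi own \<rho> \<sigma> \<tau> \<circ> ?P = id"
    by (auto simp: Psi_def fun_eq_iff vec_eq_iff mult.assoc[symmetric])
  show "bij (Psi own \<rho> \<sigma> \<tau>)" using PQ QP by (rule o_bij)
  show "inv (Psi own \<rho> \<sigma> \<tau>) = ?P" using QP PQ by (rule inv_unique_comp)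
qed

section \<open>Convergence of the distributed algorithm\<close>

theorem theorem1:
  fixes own :: "'d::finite \<Rightarrow> 'i::finite"
    and f :: "'i \<Rightarrow> real^'d \<Rightarrow> real"
    and g :: "'i \<Rightarrow> real^'d \<Rightarrow> ereal"
    and A :: "real^'d^'m::finite"
    and bs :: "'i \<Rightarrow> real^'m"
    and W :: "real^'i^'i"
    and \<beta> :: real
    and \<rho> \<sigma> \<tau> :: "'i \<Rightarrow> real"
    and u v :: "nat \<Rightarrow> ('i, 'd, 'm) H"
    and x0 :: "real^'d" and z0 l0 :: "real^('i \<times> 'm)"
  assumes g_gt_minf: "\<And>i y. y \<in> strat own i \<Longrightarrow> g i y > - \<infinity>"
    and g_lsc: "\<And>i. lsc_fun (strat own i) (g i)"
    and g_convex: "\<And>i. econvex (strat own i) (g i)"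
    and Omega_closed: "\<And>i. closed (Omega_i own g i)"
    and Omega_convex: "\<And>i. convex (Omega_i own g i)"
    and f_convex: "\<And>i x. convex_on (strat own i) (\<lambda>y. f i (join own i y x))"
    and f_C1: "\<And>i x. C1_own own f i x"
    and slater: "slater own g A bs"
    and F_monotone: "\<And>x y. x \<in> Omega own g \<Longrightarrow> y \<in> Omega own g \<Longrightarrow>
          (pseudograd own f x - pseudograd own f y) \<bullet> (x - y) \<ge> 0"
    and beta_pos: "\<beta> > 0"
    and F_lipschitz: "(1 / \<beta>)-lipschitz_on (Omega own g) (pseudograd own f)"
    (* The iterates v k may leave Omega (the u k do not), and F is evaluated there:
       the Lipschitz bound is also needed between a point outside Omega and a point of Omega. *)
    and F_lipschitz_outside: "\<And>x y. x \<notin> Omega own g \<Longrightarrow> y \<in> Omega own g \<Longrightarrow>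
          norm (pseudograd own f x - pseudograd own f y) \<le> 1 / \<beta> * norm (x - y)"
    (* Not implied by the other assumptions: F is merely monotone and Omega may be unbounded. *)
    and vGNE_exists: "\<exists>x. is_vGNE own f g A bs x"
    and W_nonneg: "\<And>i j. W $ i $ j \<ge> 0"
    and W_sym: "transpose W = W"
    and W_irreducible: "irreducible_mat W"
    and steps_pos: "\<And>i. \<rho> i > 0" "\<And>i. \<sigma> i > 0" "\<And>i. \<tau> i > 0"
    and steps: "onorm (inv (Psi own \<rho> \<sigma> \<tau> :: ('i, 'd, 'm) H \<Rightarrow> ('i, 'd, 'm) H)) < 1 / LipD own \<beta> A W"
    and init: "v 0 = (x0, z0, l0)" "\<And>i. blk own i x0 \<in> Omega_i own g i" "0 \<le> l0"
    and forward_backward: "\<And>k. u k \<in> resolvent (inv (Psi own \<rho> \<sigma> \<tau>)) (opC own g)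
          (v k - inv (Psi own \<rho> \<sigma> \<tau>) (opD own f A bs W (v k)))"
    and forward: "\<And>k. v (Suc k) =
          u k + inv (Psi own \<rho> \<sigma> \<tau>) (opD own f A bs W (v k) - opD own f A bs W (u k))"
  shows "\<exists>x z l. (x, z, l) \<in> zer (\<lambda>w. {opA own f bs W w} + {opB own A W w} + opC own g w) \<and>
           v \<longlonglongrightarrow> (x, z, l) \<and> (\<lambda>k. fst (v k)) \<longlonglongrightarrow> x \<and> is_vGNE own f g A bs x"
proof -
  let ?Q = "Psi own \<rho> \<sigma> \<tau> :: ('i, 'd, 'm) H \<Rightarrow> ('i, 'd, 'm) H"
  let ?P = "inv ?Q" and ?C = "opC own g :: ('i, 'd, 'm) H \<Rightarrow> ('i, 'd, 'm) H set"
    and ?D = "opD own f A bs W"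
  let ?X = "Omega own g \<times> (UNIV \<times> {l. 0 \<le> l}) :: ('i, 'd, 'm) H set"
  have ne: "Omega_i own g i \<noteq> {}" for i
    using slater rel_interior_subset[of "Omega own g"] by (fastforce simp: slater_def Omega_def)
  have P: "linear ?P" unfolding inv_Psi[OF steps_pos] by (rule linear_Psi)
  have bij: "bij ?Q" by (rule bij_Psi[OF steps_pos])
  have PQ: "?P (?Q w) = w" for w using bij by (simp add: bij_is_inj)
  have QP: "?Q (?P w) = w" for w using bij by (simp add: bij_is_surj surj_f_inv_f)
  interpret Q: linear ?Q by (rule linear_Psi)

  have "closed (Omega own g)"
  proof -
    have "Omega own g = (\<Inter>i. blk own i -` Omega_i own g i)" by (auto simp: Omega_def)
    moreover have "closed (blk own i -` Omega_i own g i)" for i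
      using Omega_closed[of i] bounded_linear.continuous_on[OF bounded_linear_blk continuous_on_id]
      by (intro closed_vimage) (simp_all add: id_def)
    ultimately show ?thesis by (simp add: closed_INT)
  qed
  moreover have "closed {l :: real^('i \<times> 'm). 0 \<le> l}" by (rule closed_nonneg_orthant)
  ultimately have X: "closed ?X" by (intro closed_Times) simp_all
  have C_X: "w \<in> ?X" if nonempty: "?C w \<noteq> {}" for w
  proof -
    obtain x z l where w: "w = (x, z, l)" by (cases w)
    obtain s p q where "(s, p, q) \<in> ?C (x, z, l)" using nonempty w by (metis all_not_in_conv prod_cases3)
    then have s: "blk own i s \<in> subdifferential (strat own i) (g i) (blk own i x)"
      and q: "q \<in> normal_cone {l. 0 \<le> l} l" for i
      by (auto simp: opC_iff)
    have "blk own i x \<in> Omega_i own g i" for i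
      using subdifferential_edom[OF s blk_in_strat] ne[of i] by (simp add: Omega_i_def)
    then show ?thesis using q by (simp add: w Omega_def normal_cone_iff)
  qed

  have D_mono: "0 \<le> (?D w - ?D w') \<bullet> (w - w')" if "w \<in> ?X" "w' \<in> ?X" for w w'
    using that by (intro opD_monotone W_sym W_nonneg F_monotone) auto
  have D_lip: "norm (?D w - ?D w') \<le> LipD own \<beta> A W * norm (w - w')" if "w' \<in> ?X" for w w'
  proof (rule opD_lipschitz[OF beta_pos])
    show "norm (pseudograd own f (fst w) - pseudograd own f (fst w')) \<le> 1 / \<beta> * norm (fst w - fst w')"
    proof (cases "fst w \<in> Omega own g")
      case True
      then show ?thesis
        using that lipschitz_onD[OF F_lipschitz, of "fst w" "fst w'"] by (auto simp: dist_norm)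
    qed (use that F_lipschitz_outside in auto)
  qed
  have step: "onorm ?P * LipD own \<beta> A W < 1"
    using steps LipD_pos[OF beta_pos, of own A W] by (simp add: pos_less_divide_eq)
  have u_step: "?Q (v k - u k) - ?D (v k) \<in> ?C (u k)" for k
  proof -
    have "v k - ?P (?D (v k)) - u k \<in> ?P ` ?C (u k)"
      using forward_backward[of k] by (simp add: resolvent_def set_plus_singleton_iff)
    then obtain c where c: "c \<in> ?C (u k)" "v k - ?P (?D (v k)) - u k = ?P c" by blast
    have "v k - u k - ?P (?D (v k)) = ?P c" using c(2) by (simp add: algebra_simps)
    then have "?Q (v k - u k) - ?D (v k) = c" by (metis Q.diff QP)
    then show ?thesis using c(1) by simp
  qed
  obtain s0 where s0: "- ?D s0 \<in> ?C s0"
    using vGNE_exists KKT_imp_zero[OF f_C1 W_sym W_nonneg W_irreducible] is_vGNE_iff by metis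
  have Q_nonneg: "0 \<le> ?Q w \<bullet> w" for w by (rule Psi_nonneg) (rule steps_pos)+
  have C_mono: "monotone_op ?C" using g_gt_minf ne by (rule monotone_opC)
  have C_graph: "closed {(w, s). s \<in> ?C w}" using g_gt_minf g_lsc by (rule closed_graph_opC)
  have "\<exists>s. - ?D s \<in> ?C s \<and> v \<longlonglongrightarrow> s"
    by (rule fbf_converges[where P = ?P and Q = ?Q and D = ?D and C = ?C and X = ?X])
      (fact P Q.linear_axioms PQ QP Psi_symmetric Q_nonneg C_mono C_graph X C_X D_mono D_lip
        LipD_pos[OF beta_pos] step s0 u_step forward)+
  then obtain s where s: "- ?D s \<in> ?C s" and lim: "v \<longlonglongrightarrow> s" by blast
  obtain x z l where xzl: "s = (x, z, l)" by (cases s)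
  obtain l' where "KKT own f g A bs x l'"
    using zero_imp_KKT[OF f_C1 W_sym W_nonneg W_irreducible] s xzl by blast
  then have "is_vGNE own f g A bs x"
    using KKT_imp_GNE[OF g_gt_minf ne f_convex f_C1] is_vGNE_iff by blast
  moreover have "(\<lambda>k. fst (v k)) \<longlonglongrightarrow> x" using tendsto_fst[OF lim] xzl by simp
  ultimately show ?thesis using s lim xzl zer_iff by blast
qed

end
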